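(* Let $X$ be a compact zero-dimensional metric space and let $T:X\to X$ be a homeomorphism. Then the topological entropies of the functional envelopes $(C(X,X),F_T)$ and $(H(X,X),F_T)$ are either both equal to zero or both infinite. Moreover, they are equal to zero if and only if $T$ is equicontinuous.
   Context: For a compact metric space $(X,d)$, $C(X,X)$ is the space of all continuous maps $X\to X$ with the uniform metric $\varrho(\varphi,\psi)=\sup_{x\in X}d(\varphi(x),\psi(x))$, and $H(X,X)\subset C(X,X)$ is the subspace of all self-homeomorphisms of $X$, with the same uniform metric. For a homeomorphism $T:X\to X$, $F_T(\varphi)=T\circ\varphi$; it is uniformly continuous and maps $C(X,X)$ to itself and $H(X,X)$ to itself. The systems $(C(X,X),F_T)$ and $(H(X,X),F_T)$ are called functional envelopes. A homeomorphism $T$ is called equicontinuous if the family of all its forward and backward iterates $\{T^n:n\in\mathbb Z\}$ is equicontinuous. Topological entropy of a uniformly continuous map $S:Z\to Z$ of a (not necessarily compact) metric space $(Z,\varrho)$: for $n\ge1$ let $\varrho_n(x,y)=\max_{0\le j\le n-1}\varrho(S^jx,S^jy)$; for compact $K\subset Z$ and $\epsilon>0$ let $\mathrm{sep}(n,\epsilon;K)$ be the maximal cardinality of a set $E\subset K$ with $\varrho_n(x,y)>\epsilon$ for all distinct $x,y\in E$. Then $h_{\mathrm{top}}(S,K)=\lim_{\epsilon\to0}\limsup_{n\to\infty}\frac1n\log\mathrm{sep}(n,\epsilon;K)$ and $h_{\mathrm{top}}(S)=\sup_K h_{\mathrm{top}}(S,K)$ over all compact $K\subset Z$. *)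

theory Defs
  imports "HOL-Analysis.Analysis"
begin

section \<open>Spaces of self-maps with the uniform metric\<close>

text \<open>
  A metric space is a value of the library type \<^typ>\<open>'a metric\<close>, with carrier \<^const>\<open>mspace\<close>
  and distance \<^const>\<open>mdist\<close>. A map between carriers is represented by its unique
  extensional representative, so that equality of maps is equality of functions.
\<close>

definition selfmaps :: "'a metric \<Rightarrow> ('a \<Rightarrow> 'a) set" where
  "selfmaps X =
     {\<phi> \<in> extensional (mspace X). continuous_map (mtopology_of X) (mtopology_of X) \<phi>}"

text \<open>
  The library's axioms require distances to be nonnegative also outside the carrier, and a
  supremum of reals over the empty set is unspecified; hence the default value 0. It
  matters only outside \<open>selfmaps X\<close> or for empty \<open>X\<close>.
\<close>

definition uniform_dist :: "'a metric \<Rightarrow> ('a \<Rightarrow> 'a) \<Rightarrow> ('a \<Rightarrow> 'a) \<Rightarrow> real" where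
  "uniform_dist X \<phi> \<psi> =
     (if \<phi> \<in> selfmaps X \<and> \<psi> \<in> selfmaps X \<and> mspace X \<noteq> {}
      then (SUP x\<in>mspace X. mdist X (\<phi> x) (\<psi> x)) else 0)"

definition continuous_selfmaps :: "'a metric \<Rightarrow> ('a \<Rightarrow> 'a) metric" where
  "continuous_selfmaps X = metric (selfmaps X, uniform_dist X)"

definition self_homeomorphisms :: "'a metric \<Rightarrow> ('a \<Rightarrow> 'a) metric" where
  "self_homeomorphisms X =
     submetric (continuous_selfmaps X)
       {\<phi>. homeomorphic_map (mtopology_of X) (mtopology_of X) \<phi>}"

text \<open>
  The function \<^const>\<open>compose\<close> is composition restricted to the carrier, so it preserves
  extensionality.
\<close>

definition envelope_map :: "'a metric \<Rightarrow> ('a \<Rightarrow> 'a) \<Rightarrow> ('a \<Rightarrow> 'a) \<Rightarrow> ('a \<Rightarrow> 'a)" where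
  "envelope_map X T \<phi> = compose (mspace X) T \<phi>"

text \<open>
  The constructor \<^const>\<open>metric\<close> is only meaningful on pairs satisfying the metric space axioms.
  For compact \<open>X\<close> they hold, so carriers and distances are the intended ones.
\<close>

lemma selfmaps_image: "\<phi> \<in> selfmaps X \<Longrightarrow> x \<in> mspace X \<Longrightarrow> \<phi> x \<in> mspace X"
  using continuous_map_image_subset_topspace[of "mtopology_of X" "mtopology_of X" \<phi>]
  by (auto simp: selfmaps_def)

lemma bdd_above_mdist_selfmaps:
  assumes "compact_space (mtopology_of X)" "\<phi> \<in> selfmaps X" "\<psi> \<in> selfmaps X"
  shows "bdd_above ((\<lambda>x. mdist X (\<phi> x) (\<psi> x)) ` mspace X)"
proof -
  interpret Metric_space "mspace X" "mdist X" by simp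
  have "compactin mtopology (mspace X)"
    using assms(1) by (simp add: compact_space_def mtopology_of_def)
  then have "mbounded (mspace X)"
    by (rule compactin_imp_mbounded)
  then obtain B where "\<And>x y. x \<in> mspace X \<Longrightarrow> y \<in> mspace X \<Longrightarrow> mdist X x y \<le> B"
    unfolding mbounded_alt by blast
  then show ?thesis
    using selfmaps_image[OF assms(2)] selfmaps_image[OF assms(3)]
    by (intro bdd_aboveI2[where M = B]) simp
qed

lemma Metric_space_selfmaps:
  assumes cpt: "compact_space (mtopology_of X)"
  shows "Metric_space (selfmaps X) (uniform_dist X)"
proof (cases "mspace X = {}")
  case True
  then have "\<phi> = \<psi>" if "\<phi> \<in> selfmaps X" "\<psi> \<in> selfmaps X" for \<phi> \<psi>
    using that by (auto simp: selfmaps_def)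
  then show ?thesis
    using True by unfold_locales (auto simp: uniform_dist_def)
next
  case False
  then obtain a where a: "a \<in> mspace X" by blast
  have up: "mdist X (\<phi> x) (\<psi> x) \<le> uniform_dist X \<phi> \<psi>"
    if "\<phi> \<in> selfmaps X" "\<psi> \<in> selfmaps X" "x \<in> mspace X" for \<phi> \<psi> x
  proof -
    have "mdist X (\<phi> x) (\<psi> x) \<le> (SUP x\<in>mspace X. mdist X (\<phi> x) (\<psi> x))"
      by (rule cSUP_upper[OF that(3) bdd_above_mdist_selfmaps[OF cpt that(1,2)]])
    then show ?thesis
      using that False by (simp add: uniform_dist_def)
  qed
  show ?thesis
  proof
    show "0 \<le> uniform_dist X \<phi> \<psi>" for \<phi> \<psi>
    proof (cases "\<phi> \<in> selfmaps X \<and> \<psi> \<in> selfmaps X")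
      case True
      then have "mdist X (\<phi> a) (\<psi> a) \<le> uniform_dist X \<phi> \<psi>"
        using up a by simp
      then show ?thesis
        using mdist_nonneg[of X "\<phi> a" "\<psi> a"] by linarith
    qed (auto simp: uniform_dist_def)
    show "uniform_dist X \<phi> \<psi> = uniform_dist X \<psi> \<phi>" for \<phi> \<psi>
      by (simp add: uniform_dist_def mdist_commute)
    show "uniform_dist X \<phi> \<psi> = 0 \<longleftrightarrow> \<phi> = \<psi>"
      if C: "\<phi> \<in> selfmaps X" "\<psi> \<in> selfmaps X" for \<phi> \<psi>
    proof
      assume 0: "uniform_dist X \<phi> \<psi> = 0"
      show "\<phi> = \<psi>"
      proof (rule extensionalityI[of _ "mspace X"])
        fix x assume x: "x \<in> mspace X"
        have "mdist X (\<phi> x) (\<psi> x) = 0"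
          using up[OF C x] 0 mdist_nonneg[of X "\<phi> x" "\<psi> x"] by linarith
        then show "\<phi> x = \<psi> x"
          using selfmaps_image[OF C(1) x] selfmaps_image[OF C(2) x] by simp
      qed (use C in \<open>auto simp: selfmaps_def\<close>)
    next
      assume "\<phi> = \<psi>"
      moreover have "mdist X (\<psi> x) (\<psi> x) = 0" if "x \<in> mspace X" for x
        using selfmaps_image[OF C(2) that] by simp
      ultimately show "uniform_dist X \<phi> \<psi> = 0"
        using False by (simp add: uniform_dist_def cong: SUP_cong)
    qed
    show "uniform_dist X \<phi> \<theta> \<le> uniform_dist X \<phi> \<psi> + uniform_dist X \<psi> \<theta>"
      if C: "\<phi> \<in> selfmaps X" "\<psi> \<in> selfmaps X" "\<theta> \<in> selfmaps X" for \<phi> \<psi> \<theta>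
    proof -
      have "mdist X (\<phi> x) (\<theta> x) \<le> uniform_dist X \<phi> \<psi> + uniform_dist X \<psi> \<theta>"
        if x: "x \<in> mspace X" for x
        using mdist_triangle[of "\<phi> x" X "\<psi> x" "\<theta> x"] up[OF C(1,2) x] up[OF C(2,3) x]
          selfmaps_image[OF C(1) x] selfmaps_image[OF C(2) x] selfmaps_image[OF C(3) x]
        by linarith
      then have "(SUP x\<in>mspace X. mdist X (\<phi> x) (\<theta> x)) \<le> uniform_dist X \<phi> \<psi> + uniform_dist X \<psi> \<theta>"
        using False by (intro cSUP_least) auto
      then show ?thesis
        using C False by (simp add: uniform_dist_def)
    qed
  qed
qed

lemma
  assumes "compact_space (mtopology_of X)"
  shows mspace_continuous_selfmaps: "mspace (continuous_selfmaps X) = selfmaps X"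
    and mdist_continuous_selfmaps: "mdist (continuous_selfmaps X) = uniform_dist X"
    and mspace_self_homeomorphisms: "mspace (self_homeomorphisms X) =
      {\<phi> \<in> extensional (mspace X). homeomorphic_map (mtopology_of X) (mtopology_of X) \<phi>}"
    and mdist_self_homeomorphisms: "mdist (self_homeomorphisms X) = uniform_dist X"
proof -
  interpret Metric_space "selfmaps X" "uniform_dist X"
    by (rule Metric_space_selfmaps[OF assms])
  show *: "mspace (continuous_selfmaps X) = selfmaps X"
    "mdist (continuous_selfmaps X) = uniform_dist X"
    by (simp_all add: continuous_selfmaps_def)
  show "mspace (self_homeomorphisms X) =
      {\<phi> \<in> extensional (mspace X). homeomorphic_map (mtopology_of X) (mtopology_of X) \<phi>}"
    by (auto simp: self_homeomorphisms_def * selfmaps_def homeomorphic_imp_continuous_map)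
  show "mdist (self_homeomorphisms X) = uniform_dist X"
    by (simp add: self_homeomorphisms_def *)
qed


section \<open>Equicontinuous homeomorphisms\<close>

definition equicontinuous_family :: "'a metric \<Rightarrow> ('a \<Rightarrow> 'a) set \<Rightarrow> bool" where
  "equicontinuous_family X \<F> \<longleftrightarrow>
     (\<forall>x\<in>mspace X. \<forall>\<epsilon>>0. \<exists>\<delta>>0. \<forall>f\<in>\<F>. \<forall>y\<in>mspace X.
        mdist X x y < \<delta> \<longrightarrow> mdist X (f x) (f y) < \<epsilon>)"

text \<open>
  The inverse is taken relative to the carrier, since a homeomorphism of \<open>X\<close> is
  constrained only on \<open>mspace X\<close>.
\<close>

definition all_iterates :: "'a metric \<Rightarrow> ('a \<Rightarrow> 'a) \<Rightarrow> ('a \<Rightarrow> 'a) set" where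
  "all_iterates X T =
     range (\<lambda>n::nat. T ^^ n) \<union> range (\<lambda>n::nat. inv_into (mspace X) T ^^ n)"

definition equicontinuous_homeo :: "'a metric \<Rightarrow> ('a \<Rightarrow> 'a) \<Rightarrow> bool" where
  "equicontinuous_homeo X T \<longleftrightarrow> equicontinuous_family X (all_iterates X T)"


section \<open>Topological entropy on metric spaces\<close>

text \<open>
  The definitions are intended for a uniformly continuous \<open>S\<close> mapping \<open>mspace Z\<close> to itself
  and for \<open>n \<ge> 1\<close>; the value at \<open>n = 0\<close> does not affect the limit superior.
\<close>

definition bowen_dist :: "'b metric \<Rightarrow> ('b \<Rightarrow> 'b) \<Rightarrow> nat \<Rightarrow> 'b \<Rightarrow> 'b \<Rightarrow> real" where
  "bowen_dist Z S n x y = Max ((\<lambda>j. mdist Z ((S ^^ j) x) ((S ^^ j) y)) ` {..<n})"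

definition separated :: "'b metric \<Rightarrow> ('b \<Rightarrow> 'b) \<Rightarrow> nat \<Rightarrow> real \<Rightarrow> 'b set \<Rightarrow> bool" where
  "separated Z S n \<epsilon> E \<longleftrightarrow> (\<forall>x\<in>E. \<forall>y\<in>E. x \<noteq> y \<longrightarrow> bowen_dist Z S n x y > \<epsilon>)"

text \<open>
  For compact \<open>K\<close>, uniformly continuous \<open>S\<close>, \<open>n \<ge> 1\<close> and \<open>\<epsilon> > 0\<close> these cardinalities are
  bounded, so the supremum (in \<^typ>\<open>nat\<close>) is a maximum.
\<close>

definition sep :: "'b metric \<Rightarrow> ('b \<Rightarrow> 'b) \<Rightarrow> nat \<Rightarrow> real \<Rightarrow> 'b set \<Rightarrow> nat" where
  "sep Z S n \<epsilon> K = Sup {card E |E. E \<subseteq> K \<and> finite E \<and> separated Z S n \<epsilon> E}"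

text \<open>
  For \<open>K = {}\<close> the value is 0 because \<open>ln 0 = 0\<close>; on a nonempty space this
  does not change the supremum over all compact sets, which is nonnegative anyway.
\<close>

definition entropy_on :: "'b metric \<Rightarrow> ('b \<Rightarrow> 'b) \<Rightarrow> 'b set \<Rightarrow> ereal" where
  "entropy_on Z S K =
     Lim (at_right 0) (\<lambda>\<epsilon>. limsup (\<lambda>n. ereal (1 / real n * ln (real (sep Z S n \<epsilon> K)))))"

definition top_entropy :: "'b metric \<Rightarrow> ('b \<Rightarrow> 'b) \<Rightarrow> ereal" where
  "top_entropy Z S = (SUP K\<in>{K. compactin (mtopology_of Z) K}. entropy_on Z S K)"

end

theory Submission
  imports Defs "HOL-Combinatorics.Permutations"
begin

text \<open>
  If the forward iterates of \<open>T\<close> are uniformly equicontinuous, then uniformly close maps stay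
  uniformly close under all iterates of \<open>F\<^sub>T\<close>, so separated subsets of a compact set have bounded
  size and the entropy vanishes. Equicontinuity of the forward iterates passes to the backward ones
  because orbits of pairs of points are recurrent.

  If equicontinuity fails, color \<open>X\<close> by finitely many clopen sets so that some pairs \<open>x, y\<close> keep the
  same color for \<open>n\<close> steps and differ at step \<open>n\<close>, for arbitrarily large \<open>n\<close>. The points \<open>T\<^sup>i x\<close> and
  \<open>T\<^sup>i y\<close> then show more than \<open>n\<close> different color itineraries, so a number of them linear in \<open>n\<close> lies on one
  orbit and in one prescribed small clopen piece. Small neighbourhoods of these \<open>m\<close> points, transported
  by powers of \<open>T\<close>, can be permuted arbitrarily by homeomorphisms close to the identity, which gives
  \<open>m!\<close> separated homeomorphisms. This number is superexponential in \<open>n\<close>. Sets of this kind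
  shrinking to the identity form, together with it, a compact set of infinite entropy.
\<close>

section \<open>Separated sets and null sequences in compact sets\<close>

text \<open>Finitely many balls of radius \<open>\<delta>/2\<close> cover \<open>K\<close>, and none
  of them contains two points at distance at least \<open>\<delta>\<close>; assigning to each point
  a ball around it is therefore injective on \<open>E\<close>.\<close>

lemma compactin_separated_card_bounded:
  assumes "compactin (mtopology_of Z) K" "\<delta> > 0"
  shows "\<exists>B. \<forall>E. E \<subseteq> K \<longrightarrow> finite E \<longrightarrow>
    (\<forall>x\<in>E. \<forall>y\<in>E. x \<noteq> y \<longrightarrow> mdist Z x y \<ge> \<delta>) \<longrightarrow> card E \<le> B"
proof -
  interpret Metric_space "mspace Z" "mdist Z" by simp
  have "mtotally_bounded K"
    using assms(1) by (simp add: mtopology_of_def compactin_imp_mtotally_bounded)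
  then obtain C where C: "finite C" "K \<subseteq> (\<Union>x\<in>C. mball x (\<delta>/2))"
    using assms(2) unfolding mtotally_bounded_def by (meson half_gt_zero)
  show ?thesis
  proof (intro exI allI impI)
    fix E assume E: "E \<subseteq> K" "finite E"
      and far: "\<forall>x\<in>E. \<forall>y\<in>E. x \<noteq> y \<longrightarrow> mdist Z x y \<ge> \<delta>"
    have "\<forall>x\<in>E. \<exists>c\<in>C. x \<in> mball c (\<delta>/2)" using C(2) E(1) by blast
    then obtain f where f: "\<And>x. x \<in> E \<Longrightarrow> f x \<in> C \<and> x \<in> mball (f x) (\<delta>/2)" by metis
    have "inj_on f E"
    proof (rule inj_onI, rule ccontr)
      fix x y assume xy: "x \<in> E" "y \<in> E" "f x = f y" "x \<noteq> y"
      have "mdist Z x y \<le> mdist Z (f x) x + mdist Z (f x) y"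
        using f[OF xy(1)] f[OF xy(2)] xy(3) triangle'[of x "f x" y] by (auto simp: commute)
      then show False using f[OF xy(1)] f[OF xy(2)] xy far by fastforce
    qed
    then show "card E \<le> card C" using f C(1) by (metis card_inj_on_le image_subsetI)
  qed
qed

text \<open>A cover member around \<open>p\<close> contains all \<open>E k\<close> from some index
  on, and the earlier sets leave only finitely many points. This yields the compact set of infinite
  entropy.\<close>

lemma (in Metric_space) compactin_insert_null_sequence:
  assumes p: "p \<in> M" and fin: "\<And>k. finite (E k)" and sub: "\<And>k. E k \<subseteq> M"
    and near: "\<And>k x. x \<in> E k \<Longrightarrow> d p x \<le> 1 / real (Suc k)"
  shows "compactin mtopology (insert p (\<Union>k::nat. E k))"
  unfolding compactin_def
proof (intro conjI allI impI)
  show "insert p (\<Union>k. E k) \<subseteq> topspace mtopology" using p sub by auto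
  fix \<U> assume \<U>: "(\<forall>U\<in>\<U>. openin mtopology U) \<and> insert p (\<Union>k. E k) \<subseteq> \<Union>\<U>"
  then obtain V where V: "V \<in> \<U>" "p \<in> V" by auto
  then obtain r where r: "r > 0" "mball p r \<subseteq> V" using \<U> by (meson openin_mtopology)
  obtain n where n: "1 / real (Suc n) < r" using r(1) nat_approx_posE by metis
  have tail: "E k \<subseteq> V" if "k \<ge> n" for k
  proof
    fix x assume x: "x \<in> E k"
    have "1 / real (Suc k) \<le> 1 / real (Suc n)" using that by (simp add: field_simps)
    then have "d p x < r" using near[OF x] n by linarith
    then have "x \<in> mball p r" using p sub[of k] x by auto
    then show "x \<in> V" using r(2) by blast
  qed
  define F where "F = (\<Union>k<n. E k)"
  have "finite F" unfolding F_def using fin by auto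
  moreover have "\<forall>x\<in>F. \<exists>W\<in>\<U>. x \<in> W" unfolding F_def using \<U> by blast
  then obtain g where g: "\<And>x. x \<in> F \<Longrightarrow> g x \<in> \<U> \<and> x \<in> g x" by metis
  ultimately show "\<exists>\<F>. finite \<F> \<and> \<F> \<subseteq> \<U> \<and> insert p (\<Union>k. E k) \<subseteq> \<Union>\<F>"
  proof (intro exI conjI)
    show "finite (insert V (g ` F))" if "finite F" using that by simp
    show "insert V (g ` F) \<subseteq> \<U>" using V g by auto
    show "insert p (\<Union>k. E k) \<subseteq> \<Union>(insert V (g ` F))"
    proof
      fix x assume "x \<in> insert p (\<Union>k. E k)"
      then consider "x = p" | k where "x \<in> E k" by blast
      then have "x \<in> V \<or> x \<in> F"
      proof cases
        case 2
        then show ?thesis using tail[of k] by (cases "k < n") (auto simp: F_def)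
      qed (use V in simp)
      then show "x \<in> \<Union>(insert V (g ` F))" using g by blast
    qed
  qed
qed

section \<open>Counting words, fibres and permutations\<close>

text \<open>Each branching at depth \<open>j\<close> makes the number of prefixes grow from length \<open>j\<close> to length \<open>j + 1\<close>.\<close>

lemma card_words_ge:
  fixes w :: "'p \<Rightarrow> nat \<Rightarrow> 'c"
  assumes "finite P" "P \<noteq> {}"
    and "\<And>j. j < n \<Longrightarrow> \<exists>u\<in>P. \<exists>v\<in>P. (\<forall>t<j. w u t = w v t) \<and> w u j \<noteq> w v j"
  shows "n + 1 \<le> card ((\<lambda>u. map (w u) [0..<n]) ` P)"
  using assms(3)
proof (induction n)
  case 0
  then show ?case using assms(1,2) by (simp add: Suc_le_eq card_gt_0_iff)
next
  case (Suc n)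
  let ?W = "\<lambda>n. (\<lambda>u. map (w u) [0..<n]) ` P"
  \<comment> \<open>Deleting the last letter maps the longer words onto the shorter ones; equal
    counts would make this map injective, against the branching at depth \<open>n\<close>.\<close>
  have but: "?W n = butlast ` ?W (Suc n)" by (auto simp: image_image)
  have le: "card (?W n) \<le> card (?W (Suc n))"
    unfolding but by (rule card_image_le) (use assms(1) in simp)
  have "card (?W n) \<noteq> card (?W (Suc n))"
  proof
    assume "card (?W n) = card (?W (Suc n))"
    then have inj: "inj_on butlast (?W (Suc n))"
      unfolding but using assms(1) by (intro eq_card_imp_inj_on) auto
    obtain u v where uv: "u \<in> P" "v \<in> P" "\<forall>t<n. w u t = w v t" "w u n \<noteq> w v n"
      using Suc.prems[of n] by auto
    then have "butlast (map (w u) [0..<Suc n]) = butlast (map (w v) [0..<Suc n])" by simp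
    then have "map (w u) [0..<Suc n] = map (w v) [0..<Suc n]"
      by (rule inj_onD[OF inj]) (use uv(1,2) in \<open>blast+\<close>)
    then show False using uv(4) by simp
  qed
  moreover have "n + 1 \<le> card (?W n)" using Suc.prems by (intro Suc.IH) auto
  ultimately show ?case using le by linarith
qed

text \<open>The largest fibre has at least average size; the product form avoids division of natural
  numbers.\<close>

lemma pigeonhole_card_mult:
  assumes "finite I" "finite B" "B \<noteq> {}" "f ` I \<subseteq> B"
  obtains b where "b \<in> B" "card I \<le> card B * card {i \<in> I. f i = b}"
proof -
  let ?m = "Max ((\<lambda>b. card {i \<in> I. f i = b}) ` B)"
  have "?m \<in> (\<lambda>b. card {i \<in> I. f i = b}) ` B" using assms by (intro Max_in) auto
  then obtain b where b: "b \<in> B" "?m = card {i \<in> I. f i = b}" by auto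
  have "card I = (\<Sum>b\<in>B. card {i \<in> I. f i = b})"
    using card_eq_sum sum.group[OF assms(1,2,4), of "\<lambda>_. 1::nat"] by simp
  also have "\<dots> \<le> card B * ?m" using assms(2) sum_bounded_above[of B _ ?m] by simp
  finally show thesis using that b by simp
qed

text \<open>The quotients of \<open>C ^ m\<close> by \<open>fact m\<close> are the terms of the
  exponential series and tend to 0. This is why the number of permutations outgrows every
  exponential rate.\<close>

lemma eventually_power_le_fact: "\<forall>\<^sub>F m in sequentially. (C::real) ^ m \<le> fact m"
proof -
  have "(\<lambda>m. inverse (fact m) * C ^ m) \<longlonglongrightarrow> 0"
    by (rule summable_LIMSEQ_zero[OF summable_exp])
  then have "\<forall>\<^sub>F m in sequentially. inverse (fact m) * C ^ m < 1"
    by (rule order_tendstoD) simp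
  then show ?thesis
    by eventually_elim (simp add: field_simps)
qed

section \<open>Entropy from bounds on separated sets\<close>

lemma sep_le:
  assumes "\<And>E. E \<subseteq> K \<Longrightarrow> finite E \<Longrightarrow> separated Z S n \<epsilon> E \<Longrightarrow> card E \<le> B"
  shows "sep Z S n \<epsilon> K \<le> B"
  unfolding sep_def
proof (rule cSup_least)
  have "separated Z S n \<epsilon> {}" by (simp add: separated_def)
  then show "{card E |E. E \<subseteq> K \<and> finite E \<and> separated Z S n \<epsilon> E} \<noteq> {}" by blast
qed (use assms in auto)

text \<open>\<open>Sup\<close> on \<open>nat\<close> is guaranteed to be an upper bound only for
  sets bounded above, and \<open>B\<close> supplies such a bound.\<close>

lemma card_le_sep:
  assumes "\<And>E. E \<subseteq> K \<Longrightarrow> finite E \<Longrightarrow> separated Z S n \<epsilon> E \<Longrightarrow> card E \<le> B"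
    and "E \<subseteq> K" "finite E" "separated Z S n \<epsilon> E"
  shows "card E \<le> sep Z S n \<epsilon> K"
  unfolding sep_def
  by (rule cSup_upper) (use assms in \<open>auto intro!: bdd_aboveI[where M = B]\<close>)

text \<open>At each scale the bound \<open>B\<close> serves all times, so division by
  \<open>n\<close> sends the growth rate to 0.\<close>

lemma entropy_on_eq_0:
  assumes "\<And>\<epsilon>. \<epsilon> > 0 \<Longrightarrow> \<exists>B. \<forall>n\<ge>1. sep Z S n \<epsilon> K \<le> B"
  shows "entropy_on Z S K = 0"
proof -
  have "limsup (\<lambda>n. ereal (1 / real n * ln (real (sep Z S n \<epsilon> K)))) = 0" if "\<epsilon> > 0" for \<epsilon>
  proof -
    obtain B where B: "\<And>n. n \<ge> 1 \<Longrightarrow> sep Z S n \<epsilon> K \<le> B" using assms[OF \<open>\<epsilon> > 0\<close>] by blast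
    have "(\<lambda>n. 1 / real n * ln (real (sep Z S n \<epsilon> K))) \<longlonglongrightarrow> 0"
    proof (rule tendsto_sandwich[of "\<lambda>_. 0"])
      show "(\<lambda>n. 1 / real n * ln (real (B + 1))) \<longlonglongrightarrow> 0"
        by (rule tendsto_mult_left_zero) (rule lim_1_over_n)
      show "\<forall>\<^sub>F n in sequentially. 0 \<le> 1 / real n * ln (real (sep Z S n \<epsilon> K))"
        proof (intro always_eventually allI mult_nonneg_nonneg)
        show "0 \<le> ln (real (sep Z S n \<epsilon> K))" for n
          by (cases "sep Z S n \<epsilon> K = 0") auto
      qed simp
      show "\<forall>\<^sub>F n in sequentially. 1 / real n * ln (real (sep Z S n \<epsilon> K)) \<le> 1 / real n * ln (real (B + 1))"
        using eventually_ge_at_top[of 1]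
      proof eventually_elim
        case (elim n)
        \<comment> \<open>A vanishing \<open>sep\<close> gives the default \<open>ln 0 = 0\<close>;
          the summand 1 keeps the right-hand side nonnegative also for \<open>B = 0\<close>.\<close>
        have "ln (real (sep Z S n \<epsilon> K)) \<le> ln (real (B + 1))"
          using B[OF elim] by (cases "sep Z S n \<epsilon> K = 0") auto
        then show ?case by (intro mult_left_mono) auto
      qed
    qed simp
    then have "(\<lambda>n. ereal (1 / real n * ln (real (sep Z S n \<epsilon> K)))) \<longlonglongrightarrow> ereal 0"
      by (rule tendsto_ereal)
    then show ?thesis using lim_imp_Limsup[OF sequentially_bot] by (metis zero_ereal_def)
  qed
  then have "\<forall>\<^sub>F \<epsilon> in at_right 0. limsup (\<lambda>n. ereal (1 / real n * ln (real (sep Z S n \<epsilon> K)))) = 0"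
    by (rule eventually_mono[OF eventually_at_right_less])
  then show ?thesis unfolding entropy_on_def
    by (intro tendsto_Lim tendsto_eventually) auto
qed

text \<open>A set separated at scale \<open>\<epsilon>\<^sub>0\<close> is separated at every smaller
  scale, and the limit at 0 sees only smaller scales. The assumption \<open>bnd\<close> makes the
  suprema in \<open>sep\<close> genuine.\<close>

lemma entropy_on_eq_infinity:
  assumes "\<epsilon>\<^sub>0 > 0"
    and bnd: "\<And>n \<epsilon>. n \<ge> 1 \<Longrightarrow> \<epsilon> > 0 \<Longrightarrow>
      \<exists>B. \<forall>E. E \<subseteq> K \<longrightarrow> finite E \<longrightarrow> separated Z S n \<epsilon> E \<longrightarrow> card E \<le> B"
    and big: "\<And>k::nat. \<exists>n\<ge>k. n \<ge> 1 \<and>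
      (\<exists>E. E \<subseteq> K \<and> finite E \<and> separated Z S n \<epsilon>\<^sub>0 E \<and> exp (real k * real n) \<le> real (card E))"
  shows "entropy_on Z S K = \<infinity>"
proof -
  have "limsup (\<lambda>n. ereal (1 / real n * ln (real (sep Z S n \<epsilon> K)))) = \<infinity>"
    if \<epsilon>: "0 < \<epsilon>" "\<epsilon> < \<epsilon>\<^sub>0" for \<epsilon>
  proof -
    have ge: "\<exists>n\<ge>k. 1 / real n * ln (real (sep Z S n \<epsilon> K)) \<ge> real k" for k
    proof -
      obtain n E where n: "n \<ge> k" "n \<ge> 1" and E: "E \<subseteq> K" "finite E" "separated Z S n \<epsilon>\<^sub>0 E"
        "exp (real k * real n) \<le> real (card E)" using big[of k] by blast
      obtain B where B: "\<And>E. E \<subseteq> K \<Longrightarrow> finite E \<Longrightarrow> separated Z S n \<epsilon> E \<Longrightarrow> card E \<le> B"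
        using bnd[OF n(2) \<epsilon>(1)] by blast
      have "separated Z S n \<epsilon> E" using E(3) \<epsilon>(2) unfolding separated_def by fastforce
      then have "card E \<le> sep Z S n \<epsilon> K" using card_le_sep[OF B] E by blast
      then have le: "exp (real k * real n) \<le> real (sep Z S n \<epsilon> K)" using E(4) by linarith
      then have "0 < real (sep Z S n \<epsilon> K)" by (meson exp_gt_zero less_le_trans)
      then have "real k * real n \<le> ln (real (sep Z S n \<epsilon> K))" using le by (simp add: ln_ge_iff)
      then show ?thesis using n by (intro exI[of _ n]) (auto simp: field_simps)
    qed
    have top: "(SUP n\<in>{N..}. ereal (1 / real n * ln (real (sep Z S n \<epsilon> K)))) = \<infinity>" for N
    proof (rule SUP_PInfty)
      fix m :: nat
      \<comment> \<open>The maximum puts one index beyond \<open>N\<close> and at the same time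
        makes its rate at least \<open>m\<close>.\<close>
      obtain n where n: "n \<ge> max N m" "1 / real n * ln (real (sep Z S n \<epsilon> K)) \<ge> real (max N m)"
        using ge by blast
      then have "ereal (real m) \<le> ereal (1 / real n * ln (real (sep Z S n \<epsilon> K)))" by simp
      then show "\<exists>n\<in>{N..}. ereal (real m) \<le> ereal (1 / real n * ln (real (sep Z S n \<epsilon> K)))"
        using n(1) by (intro bexI[of _ n]) auto
    qed
    show ?thesis unfolding limsup_INF_SUP top by simp
  qed
  then have "\<forall>\<^sub>F \<epsilon> in at_right 0. limsup (\<lambda>n. ereal (1 / real n * ln (real (sep Z S n \<epsilon> K)))) = \<infinity>"
    using assms(1) by (auto simp: eventually_at_right_field)
  then show ?thesis unfolding entropy_on_def
    by (intro tendsto_Lim tendsto_eventually) auto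
qed

section \<open>Iterates of a homeomorphism of a compact space\<close>

locale compact_homeomorphism =
  fixes X :: "'a metric" and T :: "'a \<Rightarrow> 'a"
  assumes compact: "compact_space (mtopology_of X)"
    and homeo: "homeomorphic_map (mtopology_of X) (mtopology_of X) T"
begin

abbreviation M where "M \<equiv> mspace X"
abbreviation d where "d \<equiv> mdist X"
abbreviation S where "S \<equiv> inv_into M T"

sublocale Metric_space M d by simp

lemma compactin_M: "compactin mtopology M"
  using compact by (simp add: mtopology_of_def compact_space_def)

lemma bij_T: "bij_betw T M M"
  using homeo homeomorphic_imp_injective_map homeomorphic_imp_surjective_map
  by (fastforce simp: bij_betw_def)

text \<open>The continuous inverse agrees with \<open>S\<close> on the carrier, continuity on a
  compact space is uniform, and composition preserves it.\<close>

lemma uniformly_continuous_funpow: "uniformly_continuous_map X X (T ^^ n)"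
  and uniformly_continuous_inv_funpow: "uniformly_continuous_map X X (S ^^ n)"
proof -
  obtain g where g: "homeomorphic_maps (mtopology_of X) (mtopology_of X) T g"
    using homeo homeomorphic_map_maps by blast
  have "g y = S y" if "y \<in> M" for y
    using g that bij_T unfolding homeomorphic_maps_def
    by (metis bij_betw_def f_inv_into_f inv_into_into topspace_mtopology_of)
  then have "continuous_map (mtopology_of X) (mtopology_of X) S"
    using g continuous_map_eq unfolding homeomorphic_maps_def
    by (metis topspace_mtopology_of)
  then have uS: "uniformly_continuous_map X X S" and uT: "uniformly_continuous_map X X T"
    using continuous_imp_uniformly_continuous_map compact homeo homeomorphic_imp_continuous_map
    by blast+
  show "uniformly_continuous_map X X (T ^^ n)"
    by (induction n) (simp_all only: funpow.simps id_def uniformly_continuous_map_id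
        uniformly_continuous_map_compose[OF _ uT])
  show "uniformly_continuous_map X X (S ^^ n)"
    by (induction n) (simp_all only: funpow.simps id_def uniformly_continuous_map_id
        uniformly_continuous_map_compose[OF _ uS])
qed

lemma funpow_mem [simp]: "x \<in> M \<Longrightarrow> (T ^^ n) x \<in> M"
  and inv_funpow_mem [simp]: "x \<in> M \<Longrightarrow> (S ^^ n) x \<in> M"
  using uniformly_continuous_map_funspace[OF uniformly_continuous_funpow]
    uniformly_continuous_map_funspace[OF uniformly_continuous_inv_funpow] by blast+

lemma S_T: "x \<in> M \<Longrightarrow> S (T x) = x" and T_S: "x \<in> M \<Longrightarrow> T (S x) = x"
  using bij_T by (auto simp: bij_betw_def f_inv_into_f)

lemma inv_funpow_funpow [simp]: "x \<in> M \<Longrightarrow> (S ^^ n) ((T ^^ n) x) = x"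
proof (induction n)
  case (Suc n)
  have "(S ^^ Suc n) ((T ^^ Suc n) x) = (S ^^ n) (S (T ((T ^^ n) x)))" by (simp add: funpow_swap1)
  then show ?case using Suc S_T funpow_mem by simp
qed simp

lemma funpow_inv_funpow [simp]: "x \<in> M \<Longrightarrow> (T ^^ n) ((S ^^ n) x) = x"
proof (induction n)
  case (Suc n)
  have "(T ^^ Suc n) ((S ^^ Suc n) x) = (T ^^ n) (T (S ((S ^^ n) x)))" by (simp add: funpow_swap1)
  then show ?case using Suc T_S inv_funpow_mem by simp
qed simp

section \<open>Forward and two-sided equicontinuity\<close>

text \<open>This uniform one-sided form is what the entropy estimates use; the next two lemmas show
  that it is equivalent to \<open>equicontinuous_homeo\<close>.\<close>

definition forward_equicontinuous :: bool where
  "forward_equicontinuous \<longleftrightarrow>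
     (\<forall>\<epsilon>>0. \<exists>\<delta>>0. \<forall>n. \<forall>x\<in>M. \<forall>y\<in>M. d x y < \<delta> \<longrightarrow> d ((T ^^ n) x) ((T ^^ n) y) < \<epsilon>)"

text \<open>A Lebesgue number of the cover by balls of pointwise equicontinuity is a uniform radius.
  Both points are compared with the center of a ball, each at a cost of
  \<open>\<epsilon> / 2\<close>.\<close>

lemma equicontinuous_imp_forward:
  assumes "equicontinuous_homeo X T"
  shows forward_equicontinuous
  unfolding forward_equicontinuous_def
proof (intro allI impI)
  fix \<epsilon> :: real assume "\<epsilon> > 0"
  then have "\<forall>x\<in>M. \<exists>\<delta>>0. \<forall>f\<in>all_iterates X T. \<forall>y\<in>M. d x y < \<delta> \<longrightarrow> d (f x) (f y) < \<epsilon> / 2"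
    using assms unfolding equicontinuous_homeo_def equicontinuous_family_def by (meson half_gt_zero)
  then obtain r where r: "\<And>x. x \<in> M \<Longrightarrow> r x > 0"
    and eq: "\<And>x f y. x \<in> M \<Longrightarrow> f \<in> all_iterates X T \<Longrightarrow> y \<in> M \<Longrightarrow> d x y < r x \<Longrightarrow> d (f x) (f y) < \<epsilon> / 2"
    by metis
  have "\<exists>\<delta>>0. \<forall>x\<in>M. \<exists>U\<in>(\<lambda>z. mball z (r z)) ` M. mball x \<delta> \<subseteq> U"
    by (rule lebesgue_number[OF compactin_M]) (use r in auto)
  then obtain \<delta> where \<delta>: "\<delta> > 0" "\<And>x. x \<in> M \<Longrightarrow> \<exists>z\<in>M. mball x \<delta> \<subseteq> mball z (r z)" by auto
  show "\<exists>\<delta>>0. \<forall>n. \<forall>x\<in>M. \<forall>y\<in>M. d x y < \<delta> \<longrightarrow> d ((T ^^ n) x) ((T ^^ n) y) < \<epsilon>"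
  proof (intro exI conjI allI ballI impI)
    fix n x y assume xy: "x \<in> M" "y \<in> M" "d x y < \<delta>"
    obtain z where z: "z \<in> M" "mball x \<delta> \<subseteq> mball z (r z)" using \<delta>(2) xy(1) by blast
    have "x \<in> mball x \<delta>" "y \<in> mball x \<delta>" using xy \<delta>(1) by auto
    then have "x \<in> mball z (r z)" "y \<in> mball z (r z)" using z(2) by blast+
    then have near: "d z x < r z" "d z y < r z" by auto
    have "T ^^ n \<in> all_iterates X T" unfolding all_iterates_def by blast
    then have "d ((T ^^ n) z) ((T ^^ n) x) < \<epsilon> / 2" "d ((T ^^ n) z) ((T ^^ n) y) < \<epsilon> / 2"
      using eq z(1) xy near by blast+
    then show "d ((T ^^ n) x) ((T ^^ n) y) < \<epsilon>"
      using triangle''[of "(T ^^ n) x" "(T ^^ n) z" "(T ^^ n) y"] xy z(1) 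
      by (smt (verit) commute field_sum_of_halves funpow_mem triangle)
  qed (rule \<delta>(1))
qed

text \<open>Let \<open>u\<close>, \<open>v\<close> be the \<open>m\<close>-th backward images of
  close points \<open>x\<close>, \<open>y\<close>. Some positive multiple of \<open>m\<close>
  forward steps returns both \<open>u\<close> and \<open>v\<close> near themselves. The first
  \<open>m\<close> of these steps lead to \<open>x\<close> and \<open>y\<close>, and the remaining
  ones keep these two close, so \<open>u\<close> and \<open>v\<close> are close.\<close>

lemma forward_imp_equicontinuous:
  assumes forward_equicontinuous
  shows "equicontinuous_homeo X T"
proof -
  have inv: "\<exists>\<delta>>0. \<forall>n. \<forall>x\<in>M. \<forall>y\<in>M. d x y < \<delta> \<longrightarrow> d ((S ^^ n) x) ((S ^^ n) y) < \<epsilon>"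
    if \<epsilon>: "\<epsilon> > 0" for \<epsilon>
  proof -
    obtain \<delta> where \<delta>: "\<delta> > 0"
      and eq: "\<And>n x y. x \<in> M \<Longrightarrow> y \<in> M \<Longrightarrow> d x y < \<delta> \<Longrightarrow> d ((T ^^ n) x) ((T ^^ n) y) < \<epsilon> / 3"
      using assms \<epsilon> unfolding forward_equicontinuous_def by (metis divide_pos_pos zero_less_numeral)
    have "mtotally_bounded M" using compactin_M by (rule compactin_imp_mtotally_bounded)
    then obtain C where C: "finite C" "M \<subseteq> (\<Union>c\<in>C. mball c (\<delta>/2))"
      using \<delta> unfolding mtotally_bounded_def by (meson half_gt_zero)
    then have "\<forall>x\<in>M. \<exists>c\<in>C. x \<in> mball c (\<delta>/2)" by blast
    then obtain f where f: "\<And>x. x \<in> M \<Longrightarrow> f x \<in> C" "\<And>x. x \<in> M \<Longrightarrow> x \<in> mball (f x) (\<delta>/2)" by metis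
    have near: "d x y < \<delta>" if "x \<in> M" "y \<in> M" "f x = f y" for x y
      using f(2)[OF that(1)] f(2)[OF that(2)] that triangle[of x "f x" y] commute[of x "f x"] by auto
    have "d ((S ^^ m) x) ((S ^^ m) y) < \<epsilon>" if xy: "x \<in> M" "y \<in> M" "d x y < \<delta>" for m x y
    proof (cases "m = 0")
      case True
      then show ?thesis using eq[OF xy, of 0] \<epsilon> by simp
    next
      case False
      define u v where "u = (S ^^ m) x" and "v = (S ^^ m) y"
      have uv: "u \<in> M" "v \<in> M" using xy by (auto simp: u_def v_def)
      \<comment> \<open>The backward orbit of the pair, sampled every \<open>m\<close> steps, is
        labelled by finitely many pairs of balls, so two times share a label.\<close>
      define h where "h i = (f ((S ^^ (i * m)) u), f ((S ^^ (i * m)) v))" for i :: nat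
      have "range h \<subseteq> C \<times> C" using f(1) uv by (auto simp: h_def)
      then have "finite (range h)" using C(1) by (meson finite_SigmaI finite_subset)
      then have "\<not> inj h" using finite_imageD infinite_UNIV_nat by blast
      then obtain i j where ij: "h i = h j" "i < j" by (metis injI linorder_neqE_nat)
      \<comment> \<open>The two backward images of \<open>w\<close> are close; \<open>j * m\<close>
        forward steps take the later one to \<open>w\<close> and the earlier one to
        \<open>(T ^^ ((j - i) * m)) w\<close>.\<close>
      have recur: "d ((T ^^ ((j - i) * m)) w) w < \<epsilon> / 3"
        if w: "w \<in> M" "f ((S ^^ (i * m)) w) = f ((S ^^ (j * m)) w)" for w
      proof -
        have "d ((S ^^ (i * m)) w) ((S ^^ (j * m)) w) < \<delta>" using w by (intro near) auto
        then have "d ((T ^^ (j * m)) ((S ^^ (i * m)) w)) ((T ^^ (j * m)) ((S ^^ (j * m)) w)) < \<epsilon> / 3"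
          using w by (intro eq) auto
        moreover have "(T ^^ (j * m)) ((S ^^ (i * m)) w) = (T ^^ ((j - i) * m)) w"
        proof -
          have "T ^^ (j * m) = T ^^ ((j - i) * m) \<circ> T ^^ (i * m)"
            using ij(2) by (simp flip: funpow_add add_mult_distrib)
          then show ?thesis using w(1) by simp
        qed
        ultimately show ?thesis using w(1) by simp
      qed
      \<comment> \<open>Since \<open>i < j\<close>, at least \<open>m\<close> steps are available to
        undo \<open>S ^^ m\<close>, and the subtraction is exact.\<close>
      have fwd: "(T ^^ ((j - i) * m)) ((S ^^ m) z) = (T ^^ ((j - i) * m - m)) z" if "z \<in> M" for z
      proof -
        have "(j - i) * m = ((j - i) * m - m) + m"
          using ij(2) by (simp add: Suc_leI)
        then have "T ^^ ((j - i) * m) = T ^^ ((j - i) * m - m) \<circ> T ^^ m" by (metis funpow_add)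
        then show ?thesis using that by simp
      qed
      have "d ((T ^^ ((j - i) * m)) u) u < \<epsilon> / 3" "d ((T ^^ ((j - i) * m)) v) v < \<epsilon> / 3"
        using ij(1) recur[OF uv(1)] recur[OF uv(2)] by (simp_all add: h_def)
      moreover have "d ((T ^^ ((j - i) * m)) u) ((T ^^ ((j - i) * m)) v) < \<epsilon> / 3"
        using eq[OF xy] fwd xy by (simp add: u_def v_def)
      moreover have "d u v \<le> d ((T ^^ ((j - i) * m)) u) u + d ((T ^^ ((j - i) * m)) u) ((T ^^ ((j - i) * m)) v)
          + d ((T ^^ ((j - i) * m)) v) v"
        using triangle[of u "(T ^^ ((j - i) * m)) u" v]
          triangle[of "(T ^^ ((j - i) * m)) u" "(T ^^ ((j - i) * m)) v" v] uv
        by (simp add: commute[of u])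
      ultimately show ?thesis unfolding u_def v_def by linarith
    qed
    then show ?thesis using \<delta> by blast
  qed
  show ?thesis
    unfolding equicontinuous_homeo_def equicontinuous_family_def
  proof (intro ballI allI impI)
    fix x and \<epsilon> :: real assume x: "x \<in> M" and \<epsilon>: "\<epsilon> > 0"
    obtain \<delta>1 where 1: "\<delta>1 > 0" "\<And>n x y. x \<in> M \<Longrightarrow> y \<in> M \<Longrightarrow> d x y < \<delta>1 \<Longrightarrow> d ((T ^^ n) x) ((T ^^ n) y) < \<epsilon>"
      using assms \<epsilon> unfolding forward_equicontinuous_def by metis
    obtain \<delta>2 where 2: "\<delta>2 > 0" "\<And>n x y. x \<in> M \<Longrightarrow> y \<in> M \<Longrightarrow> d x y < \<delta>2 \<Longrightarrow> d ((S ^^ n) x) ((S ^^ n) y) < \<epsilon>"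
      using inv[OF \<epsilon>] by metis
    show "\<exists>\<delta>>0. \<forall>f\<in>all_iterates X T. \<forall>y\<in>M. d x y < \<delta> \<longrightarrow> d (f x) (f y) < \<epsilon>"
      using 1 2 x by (intro exI[of _ "min \<delta>1 \<delta>2"]) (auto simp: all_iterates_def)
  qed
qed

section \<open>Bowen distances in the functional envelopes and the equicontinuous case\<close>

lemma envelope_funpow:
  assumes "\<phi> \<in> selfmaps X"
  shows "(envelope_map X T ^^ n) \<phi> \<in> selfmaps X"
    and "x \<in> M \<Longrightarrow> (envelope_map X T ^^ n) \<phi> x = (T ^^ n) (\<phi> x)"
proof (induction n)
  case (Suc n)
  let ?\<psi> = "(envelope_map X T ^^ n) \<phi>"
  have "continuous_map (mtopology_of X) (mtopology_of X) (T \<circ> ?\<psi>)"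
    using Suc(1) homeo homeomorphic_imp_continuous_map
    by (auto simp: selfmaps_def intro: continuous_map_compose)
  then have "continuous_map (mtopology_of X) (mtopology_of X) (compose M T ?\<psi>)"
    by (rule continuous_map_eq) (auto simp: compose_def)
  then show "(envelope_map X T ^^ Suc n) \<phi> \<in> selfmaps X"
    by (simp add: selfmaps_def envelope_map_def)
  show "(envelope_map X T ^^ Suc n) \<phi> x = (T ^^ Suc n) (\<phi> x)" if "x \<in> M"
  proof -
    have "envelope_map X T ?\<psi> x = T (?\<psi> x)"
      using that by (simp add: envelope_map_def compose_def)
    then show ?thesis using Suc(2)[OF that] by simp
  qed
qed (use assms in auto)

lemma uniform_dist_ge:
  assumes "\<phi> \<in> selfmaps X" "\<psi> \<in> selfmaps X" "x \<in> M"
  shows "d (\<phi> x) (\<psi> x) \<le> uniform_dist X \<phi> \<psi>"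
proof -
  have "d (\<phi> x) (\<psi> x) \<le> (SUP x\<in>M. d (\<phi> x) (\<psi> x))"
    by (rule cSUP_upper[OF assms(3) bdd_above_mdist_selfmaps[OF compact assms(1,2)]])
  then show ?thesis using assms by (auto simp: uniform_dist_def)
qed

text \<open>The assumption \<open>r \<ge> 0\<close> covers the default value 0 of
  \<open>uniform_dist\<close>.\<close>

lemma uniform_dist_le:
  assumes "\<And>x. x \<in> M \<Longrightarrow> d (\<phi> x) (\<psi> x) \<le> r" "r \<ge> 0"
  shows "uniform_dist X \<phi> \<psi> \<le> r"
  using assms by (auto simp: uniform_dist_def intro!: cSUP_least)

text \<open>Only the distance of \<open>Z\<close> enters, so the estimate serves both
  envelopes.\<close>

lemma bowen_dist_ge:
  assumes "\<phi> \<in> selfmaps X" "\<psi> \<in> selfmaps X" "x \<in> M" "t < n"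
    and "mdist Z = uniform_dist X"
  shows "d ((T ^^ t) (\<phi> x)) ((T ^^ t) (\<psi> x)) \<le> bowen_dist Z (envelope_map X T) n \<phi> \<psi>"
proof -
  let ?F = "envelope_map X T"
  have "d ((T ^^ t) (\<phi> x)) ((T ^^ t) (\<psi> x)) \<le> mdist Z ((?F ^^ t) \<phi>) ((?F ^^ t) \<psi>)"
    using uniform_dist_ge[of "(?F ^^ t) \<phi>" "(?F ^^ t) \<psi>" x] envelope_funpow assms by metis
  also have "\<dots> \<le> bowen_dist Z ?F n \<phi> \<psi>"
    unfolding bowen_dist_def using assms(4) by (intro Max_ge) auto
  finally show ?thesis .
qed

lemma bowen_dist_le:
  assumes "\<phi> \<in> selfmaps X" "\<psi> \<in> selfmaps X" "n \<ge> 1" "\<epsilon> \<ge> 0"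
    and Z: "mdist Z = uniform_dist X"
    and T: "\<And>t x y. t < n \<Longrightarrow> x \<in> M \<Longrightarrow> y \<in> M \<Longrightarrow> d x y < \<delta> \<Longrightarrow> d ((T ^^ t) x) ((T ^^ t) y) < \<epsilon>"
    and near: "uniform_dist X \<phi> \<psi> < \<delta>"
  shows "bowen_dist Z (envelope_map X T) n \<phi> \<psi> \<le> \<epsilon>"
proof -
  let ?F = "envelope_map X T"
  have "mdist Z ((?F ^^ t) \<phi>) ((?F ^^ t) \<psi>) \<le> \<epsilon>" if "t < n" for t
    unfolding Z
  proof (rule uniform_dist_le)
    fix x assume x: "x \<in> M"
    have "d (\<phi> x) (\<psi> x) < \<delta>" using uniform_dist_ge[OF assms(1,2) x] near by linarith
    then show "d ((?F ^^ t) \<phi> x) ((?F ^^ t) \<psi> x) \<le> \<epsilon>"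
      using T[OF that selfmaps_image[OF assms(1) x] selfmaps_image[OF assms(2) x]]
        envelope_funpow assms(1,2) x by fastforce
  qed (rule assms(4))
  moreover have "{..<n} \<noteq> {}" using assms(3) by (metis lessThan_empty_iff not_one_le_zero)
  ultimately show ?thesis
    unfolding bowen_dist_def by (subst Max_le_iff) auto
qed

text \<open>The bound depends on the time \<open>n\<close> only through the modulus \<open>\<delta>\<close>.\<close>

lemma separated_card_bounded:
  assumes Z: "mdist Z = uniform_dist X" "mspace Z \<subseteq> selfmaps X"
    and K: "compactin (mtopology_of Z) K" and pos: "\<epsilon> > 0" "\<delta> > 0"
  obtains B where "\<And>n E. n \<ge> 1 \<Longrightarrow>
      (\<And>t x y. t < n \<Longrightarrow> x \<in> M \<Longrightarrow> y \<in> M \<Longrightarrow> d x y < \<delta> \<Longrightarrow> d ((T ^^ t) x) ((T ^^ t) y) < \<epsilon>) \<Longrightarrow>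
      E \<subseteq> K \<Longrightarrow> finite E \<Longrightarrow> separated Z (envelope_map X T) n \<epsilon> E \<Longrightarrow> card E \<le> B"
proof -
  obtain B where B: "\<And>E. E \<subseteq> K \<Longrightarrow> finite E \<Longrightarrow>
    \<forall>x\<in>E. \<forall>y\<in>E. x \<noteq> y \<longrightarrow> mdist Z x y \<ge> \<delta> \<Longrightarrow> card E \<le> B"
    using compactin_separated_card_bounded[OF K pos(2)] by blast
  show thesis
  proof
    fix n E assume n: "n \<ge> (1::nat)"
      and T: "\<And>t x y. t < n \<Longrightarrow> x \<in> M \<Longrightarrow> y \<in> M \<Longrightarrow> d x y < \<delta> \<Longrightarrow> d ((T ^^ t) x) ((T ^^ t) y) < \<epsilon>"
      and E: "E \<subseteq> K" "finite E" "separated Z (envelope_map X T) n \<epsilon> E"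
    have "K \<subseteq> selfmaps X" using compactin_subset_topspace[OF K] Z(2) by auto
    then have sub: "E \<subseteq> selfmaps X" using E(1) by blast
    show "card E \<le> B"
    proof (rule B[OF E(1,2)], intro ballI impI, rule ccontr)
      fix x y assume xy: "x \<in> E" "y \<in> E" "x \<noteq> y" and "\<not> \<delta> \<le> mdist Z x y"
      then have "uniform_dist X x y < \<delta>" using Z(1) by simp
      then have "bowen_dist Z (envelope_map X T) n x y \<le> \<epsilon>"
        using bowen_dist_le[of x y n \<epsilon> Z \<delta>] n pos(1) Z(1) T xy sub by auto
      then show False using E(3) xy unfolding separated_def by force
    qed
  qed
qed

text \<open>Finitely many radii have a positive minimum. The relation \<open>P\<close> covers
  equality of colors as well as estimates of distances.\<close>

lemma common_radius:
  assumes "finite I" "\<And>i. i \<in> I \<Longrightarrow> \<exists>\<delta>>0. \<forall>x\<in>M. \<forall>y\<in>M. d x y < \<delta> \<longrightarrow> P i x y"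
  shows "\<exists>\<delta>>0. \<forall>i\<in>I. \<forall>x\<in>M. \<forall>y\<in>M. d x y < \<delta> \<longrightarrow> P i x y"
  using assms
proof (induction I rule: finite_induct)
  case empty
  then show ?case by (auto intro: exI[of _ 1])
next
  case (insert i I)
  obtain \<delta>1 where 1: "\<delta>1 > 0" "\<forall>x\<in>M. \<forall>y\<in>M. d x y < \<delta>1 \<longrightarrow> P i x y"
    using insert.prems[of i] by blast
  obtain \<delta>2 where 2: "\<delta>2 > 0" "\<forall>i\<in>I. \<forall>x\<in>M. \<forall>y\<in>M. d x y < \<delta>2 \<longrightarrow> P i x y"
    using insert.IH insert.prems by blast
  show ?case using 1 2 by (intro exI[of _ "min \<delta>1 \<delta>2"]) auto
qed

lemma uniformly_continuous_mapD:
  assumes "uniformly_continuous_map X X f" "\<epsilon> > 0"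
  shows "\<exists>\<delta>>0. \<forall>x\<in>M. \<forall>y\<in>M. d x y < \<delta> \<longrightarrow> d (f x) (f y) < \<epsilon>"
  using assms unfolding uniformly_continuous_map_def by blast

text \<open>Forward equicontinuity gives one modulus for all times, so the bound on separated sets
  does not depend on \<open>n\<close>.\<close>

lemma entropy_eq_0:
  assumes forward_equicontinuous "mdist Z = uniform_dist X" "mspace Z \<subseteq> selfmaps X"
  shows "top_entropy Z (envelope_map X T) = 0"
proof -
  have "entropy_on Z (envelope_map X T) K = 0" if K: "compactin (mtopology_of Z) K" for K
  proof (rule entropy_on_eq_0)
    fix \<epsilon> :: real assume \<epsilon>: "\<epsilon> > 0"
    obtain \<delta> where \<delta>: "\<delta> > 0" "\<And>n x y. x \<in> M \<Longrightarrow> y \<in> M \<Longrightarrow> d x y < \<delta> \<Longrightarrow> d ((T ^^ n) x) ((T ^^ n) y) < \<epsilon>"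
      using assms(1) \<epsilon> unfolding forward_equicontinuous_def by metis
    obtain B where "\<And>n E. n \<ge> 1 \<Longrightarrow> E \<subseteq> K \<Longrightarrow> finite E \<Longrightarrow>
        separated Z (envelope_map X T) n \<epsilon> E \<Longrightarrow> card E \<le> B"
      using separated_card_bounded[OF assms(2,3) K \<epsilon> \<delta>(1)] \<delta>(2) by metis
    then show "\<exists>B. \<forall>n\<ge>1. sep Z (envelope_map X T) n \<epsilon> K \<le> B"
      by (auto intro!: sep_le)
  qed
  then have "top_entropy Z (envelope_map X T) = (SUP K\<in>{K. compactin (mtopology_of Z) K}. 0)"
    unfolding top_entropy_def by (intro SUP_cong) auto
  \<comment> \<open>The empty set is compact, so the supremum runs over a nonempty family and is 0
    rather than minus infinity.\<close>
  also have "\<dots> = 0" by (intro SUP_const) (auto intro: compactin_empty)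
  finally show ?thesis .
qed

section \<open>Colorings by clopen sets\<close>

text \<open>Local constancy with a uniform radius: the color classes within \<open>M\<close> are
  clopen, and the uniform radius lets colorings be combined with each other and with uniformly
  continuous maps.\<close>

definition coloring :: "('a \<Rightarrow> 'c) \<Rightarrow> bool" where
  "coloring c \<longleftrightarrow> (\<exists>\<delta>>0. \<forall>x\<in>M. \<forall>y\<in>M. d x y < \<delta> \<longrightarrow> c x = c y)"

lemma coloring_compose:
  assumes "coloring c" "uniformly_continuous_map X X f"
  shows "coloring (\<lambda>x. c (f x))"
proof -
  obtain \<delta> where \<delta>: "\<delta> > 0" "\<forall>x\<in>M. \<forall>y\<in>M. d x y < \<delta> \<longrightarrow> c x = c y"
    using assms(1) unfolding coloring_def by blast
  obtain \<eta> where \<eta>: "\<eta> > 0" "\<forall>x\<in>M. \<forall>y\<in>M. d x y < \<eta> \<longrightarrow> d (f x) (f y) < \<delta>"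
    using uniformly_continuous_mapD[OF assms(2) \<delta>(1)] by blast
  have "f x \<in> M" if "x \<in> M" for x using uniformly_continuous_map_funspace[OF assms(2)] that by blast
  then show ?thesis unfolding coloring_def using \<delta>(2) \<eta> by blast
qed

lemma coloring_common_radius:
  assumes "finite I" "\<And>i. i \<in> I \<Longrightarrow> coloring (f i)"
  shows "\<exists>\<delta>>0. \<forall>i\<in>I. \<forall>x\<in>M. \<forall>y\<in>M. d x y < \<delta> \<longrightarrow> f i x = f i y"
  using common_radius[OF assms(1), of "\<lambda>i x y. f i x = f i y"] assms(2) unfolding coloring_def .

text \<open>The radius is a Lebesgue number of the cover by \<open>V\<close> and its
  complement.\<close>

lemma coloring_clopen:
  assumes "openin mtopology V" "closedin mtopology V"
  shows "coloring (\<lambda>x. x \<in> V)"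
proof -
  have "\<exists>\<delta>>0. \<forall>x\<in>M. \<exists>U\<in>{V, M - V}. mball x \<delta> \<subseteq> U"
    using assms by (intro lebesgue_number[OF compactin_M]) auto
  then obtain \<delta> where \<delta>: "\<delta> > 0" "\<And>x. x \<in> M \<Longrightarrow> mball x \<delta> \<subseteq> V \<or> mball x \<delta> \<subseteq> M - V" by auto
  have "x \<in> V \<longleftrightarrow> y \<in> V" if "x \<in> M" "y \<in> M" "d x y < \<delta>" for x y
  proof -
    have "x \<in> mball x \<delta>" "y \<in> mball x \<delta>" using that \<delta>(1) by auto
    then show ?thesis using \<delta>(2)[OF that(1)] by blast
  qed
  then show ?thesis unfolding coloring_def using \<delta>(1) by blast
qed

lemma coloring_separates:
  assumes "coloring c"
  obtains \<epsilon> where "\<epsilon> > 0" "\<And>x y. x \<in> M \<Longrightarrow> y \<in> M \<Longrightarrow> c x \<noteq> c y \<Longrightarrow> d x y > \<epsilon>"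
proof -
  obtain \<delta> where \<delta>: "\<delta> > 0" "\<And>x y. x \<in> M \<Longrightarrow> y \<in> M \<Longrightarrow> d x y < \<delta> \<Longrightarrow> c x = c y"
    using assms unfolding coloring_def by metis
  show thesis
  proof
    \<comment> \<open>Halving the radius yields the strict inequality that \<open>separated\<close>
      demands.\<close>
    show "d x y > \<delta> / 2" if "x \<in> M" "y \<in> M" "c x \<noteq> c y" for x y
      using \<delta>(2)[OF that(1,2)] that(3) \<delta>(1) by linarith
  qed (use \<delta>(1) in simp)
qed

text \<open>Dimension zero and compactness give finitely many clopen sets \<open>V z\<close> inside
  balls of radius \<open>\<epsilon>/2\<close> that cover the space. The color of a point is the set
  of all \<open>z\<close> with the point in \<open>V z\<close>, so points of one color share a
  ball.\<close>

lemma small_coloring: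
  assumes dim: "mtopology_of X dim_le 0" and "\<epsilon> > 0"
  obtains c :: "'a \<Rightarrow> 'a set" where "coloring c" "finite (c ` M)"
    "\<And>x y. x \<in> M \<Longrightarrow> y \<in> M \<Longrightarrow> c x = c y \<Longrightarrow> d x y < \<epsilon>"
proof -
  have "neighbourhood_base_of (\<lambda>U. closedin mtopology U \<and> openin mtopology U) mtopology"
    using dim unfolding dimension_le_0_neighbourhood_base_of_clopen mtopology_of_def .
  moreover have "openin mtopology (mball x (\<epsilon>/2)) \<and> x \<in> mball x (\<epsilon>/2)" if "x \<in> M" for x
    using that assms(2) by auto
  ultimately have "\<forall>x\<in>M. \<exists>V. closedin mtopology V \<and> openin mtopology V \<and> x \<in> V \<and> V \<subseteq> mball x (\<epsilon>/2)"
    unfolding neighbourhood_base_of by (meson subsetD)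
  then obtain V where V: "\<And>x. x \<in> M \<Longrightarrow> closedin mtopology (V x)" "\<And>x. x \<in> M \<Longrightarrow> openin mtopology (V x)"
    "\<And>x. x \<in> M \<Longrightarrow> x \<in> V x" "\<And>x. x \<in> M \<Longrightarrow> V x \<subseteq> mball x (\<epsilon>/2)" by metis
  have "\<exists>\<F>. finite \<F> \<and> \<F> \<subseteq> V ` M \<and> M \<subseteq> \<Union>\<F>"
    using compactin_M V(2,3) unfolding compactin_def by (smt (verit) UN_I image_iff subsetI)
  then obtain C where C: "finite C" "C \<subseteq> M" "M \<subseteq> (\<Union>z\<in>C. V z)"
    by (metis finite_subset_image)
  define c where "c x = {z \<in> C. x \<in> V z}" for x
  have "coloring (\<lambda>x. x \<in> V z)" if "z \<in> C" for z
    using coloring_clopen V(1,2) C(2) that by blast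
  then have "\<exists>\<delta>>0. \<forall>z\<in>C. \<forall>x\<in>M. \<forall>y\<in>M. d x y < \<delta> \<longrightarrow> (x \<in> V z \<longleftrightarrow> y \<in> V z)"
    by (rule coloring_common_radius[OF C(1)])
  then obtain \<delta> where "\<delta> > 0" "\<forall>z\<in>C. \<forall>x\<in>M. \<forall>y\<in>M. d x y < \<delta> \<longrightarrow> (x \<in> V z \<longleftrightarrow> y \<in> V z)"
    by blast
  then have "coloring c" unfolding coloring_def c_def by (intro exI[of _ \<delta>]) auto
  moreover have "finite (c ` M)"
    by (rule finite_subset[of _ "Pow C"]) (use C(1) in \<open>auto simp: c_def\<close>)
  moreover have "d x y < \<epsilon>" if xy: "x \<in> M" "y \<in> M" "c x = c y" for x y
  proof -
    obtain z where z: "z \<in> C" "x \<in> V z" using C(3) xy(1) by blast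
    then have "y \<in> V z" using xy(3) by (auto simp: c_def)
    then have "x \<in> mball z (\<epsilon>/2)" "y \<in> mball z (\<epsilon>/2)" using z V(4)[of z] C(2) by blast+
    then show ?thesis using triangle[of x z y] commute[of x z] xy by auto
  qed
  ultimately show thesis using that by blast
qed

section \<open>Homeomorphisms that permute pieces along an orbit\<close>

text \<open>
  The homeomorphism permuting the pairwise disjoint sets \<open>T\<^sup>i U\<close>, \<open>i \<in> J\<close>, along the orbit:
  it moves \<open>T\<^sup>i U\<close> onto \<open>T\<^bsup>\<sigma> i\<^esup> U\<close> by a power of \<open>T\<close>. Taking all sets on one orbit makes
  them homeomorphic without any knowledge of their structure.
\<close>

definition shuffle :: "nat set \<Rightarrow> 'a set \<Rightarrow> (nat \<Rightarrow> nat) \<Rightarrow> 'a \<Rightarrow> 'a" where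
  "shuffle J U \<sigma> = restrict (\<lambda>x. if \<exists>i\<in>J. (S ^^ i) x \<in> U
     then let i = (THE i. i \<in> J \<and> (S ^^ i) x \<in> U) in (T ^^ \<sigma> i) ((S ^^ i) x) else x) M"

context
  fixes J :: "nat set" and U :: "'a set"
  assumes finite_J: "finite J" and coloring_U: "coloring (\<lambda>x. x \<in> U)"
    and disjoint: "\<And>i j x. i \<in> J \<Longrightarrow> j \<in> J \<Longrightarrow> x \<in> M \<Longrightarrow> (S ^^ i) x \<in> U \<Longrightarrow> (S ^^ j) x \<in> U \<Longrightarrow> i = j"
begin

text \<open>The condition \<open>(S ^^ i) x \<in> U\<close> places \<open>x\<close> in the image of
  \<open>U\<close> under \<open>T ^^ i\<close>; by \<open>disjoint\<close> the index described by
  \<open>THE\<close> in \<open>shuffle\<close> is unique.\<close>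

lemma shuffle_in:
  assumes "x \<in> M" "i \<in> J" "(S ^^ i) x \<in> U"
  shows "shuffle J U \<sigma> x = (T ^^ \<sigma> i) ((S ^^ i) x)"
proof -
  have "(THE i. i \<in> J \<and> (S ^^ i) x \<in> U) = i"
    using assms disjoint by (intro the_equality) auto
  then show ?thesis using assms by (auto simp: shuffle_def)
qed

lemma shuffle_out: "x \<in> M \<Longrightarrow> \<not> (\<exists>i\<in>J. (S ^^ i) x \<in> U) \<Longrightarrow> shuffle J U \<sigma> x = x"
  by (simp add: shuffle_def)

text \<open>Sufficiently close points lie in the same piece or both outside all pieces, so the
  shuffle moves both by the same one of finitely many uniformly continuous maps.\<close>

lemma uniformly_continuous_shuffle: "uniformly_continuous_map X X (shuffle J U \<sigma>)"
  unfolding uniformly_continuous_map_def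
proof (intro conjI allI impI)
  show "shuffle J U \<sigma> \<in> M \<rightarrow> M"
  proof
    fix x assume x: "x \<in> M"
    show "shuffle J U \<sigma> x \<in> M"
    proof (cases "\<exists>i\<in>J. (S ^^ i) x \<in> U")
      case True
      then obtain i where "i \<in> J" "(S ^^ i) x \<in> U" by blast
      then show ?thesis using shuffle_in[OF x] x by simp
    next
      case False
      then show ?thesis using shuffle_out[OF x False] x by simp
    qed
  qed
  fix \<epsilon> :: real assume \<epsilon>: "\<epsilon> > 0"
  have "\<exists>\<delta>>0. \<forall>i\<in>J. \<forall>x\<in>M. \<forall>y\<in>M. d x y < \<delta> \<longrightarrow>
      ((S ^^ i) x \<in> U \<longleftrightarrow> (S ^^ i) y \<in> U) \<and> d ((T ^^ \<sigma> i) ((S ^^ i) x)) ((T ^^ \<sigma> i) ((S ^^ i) y)) < \<epsilon>"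
  proof (rule common_radius[OF finite_J])
    fix i
    obtain \<delta>1 where 1: "\<delta>1 > 0" "\<forall>x\<in>M. \<forall>y\<in>M. d x y < \<delta>1 \<longrightarrow> ((S ^^ i) x \<in> U \<longleftrightarrow> (S ^^ i) y \<in> U)"
      using coloring_compose[OF coloring_U uniformly_continuous_inv_funpow[of i]]
      unfolding coloring_def by blast
    have "uniformly_continuous_map X X (T ^^ \<sigma> i \<circ> S ^^ i)"
      by (rule uniformly_continuous_map_compose[OF uniformly_continuous_inv_funpow uniformly_continuous_funpow])
    from uniformly_continuous_mapD[OF this \<epsilon>] obtain \<delta>2 where 2: "\<delta>2 > 0"
      "\<forall>x\<in>M. \<forall>y\<in>M. d x y < \<delta>2 \<longrightarrow> d ((T ^^ \<sigma> i) ((S ^^ i) x)) ((T ^^ \<sigma> i) ((S ^^ i) y)) < \<epsilon>"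
      unfolding o_apply by blast
    show "\<exists>\<delta>>0. \<forall>x\<in>M. \<forall>y\<in>M. d x y < \<delta> \<longrightarrow> ((S ^^ i) x \<in> U \<longleftrightarrow> (S ^^ i) y \<in> U) \<and>
        d ((T ^^ \<sigma> i) ((S ^^ i) x)) ((T ^^ \<sigma> i) ((S ^^ i) y)) < \<epsilon>"
    proof (rule exI[of _ "min \<delta>1 \<delta>2"], rule conjI, simp add: 1(1) 2(1), intro ballI impI)
      fix x y assume xy: "x \<in> M" "y \<in> M" "d x y < min \<delta>1 \<delta>2"
      then have "d x y < \<delta>1" "d x y < \<delta>2" by simp_all
      then show "((S ^^ i) x \<in> U \<longleftrightarrow> (S ^^ i) y \<in> U) \<and>
          d ((T ^^ \<sigma> i) ((S ^^ i) x)) ((T ^^ \<sigma> i) ((S ^^ i) y)) < \<epsilon>"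
        using 1(2) 2(2) xy(1,2) by blast
    qed
  qed
  then obtain \<delta> where \<delta>: "\<delta> > 0" "\<And>i x y. i \<in> J \<Longrightarrow> x \<in> M \<Longrightarrow> y \<in> M \<Longrightarrow> d x y < \<delta> \<Longrightarrow>
      ((S ^^ i) x \<in> U \<longleftrightarrow> (S ^^ i) y \<in> U) \<and> d ((T ^^ \<sigma> i) ((S ^^ i) x)) ((T ^^ \<sigma> i) ((S ^^ i) y)) < \<epsilon>"
    by blast
  \<comment> \<open>The part \<open>\<epsilon>\<close> of the minimum serves points outside all
    pieces, where the shuffle is the identity.\<close>
  have "d (shuffle J U \<sigma> x) (shuffle J U \<sigma> y) < \<epsilon>"
    if xy: "x \<in> M" "y \<in> M" "d x y < min \<delta> \<epsilon>" for x y
  proof (cases "\<exists>i\<in>J. (S ^^ i) x \<in> U")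
    case True
    then obtain i where i: "i \<in> J" "(S ^^ i) x \<in> U" by blast
    then have "(S ^^ i) y \<in> U" "d ((T ^^ \<sigma> i) ((S ^^ i) x)) ((T ^^ \<sigma> i) ((S ^^ i) y)) < \<epsilon>"
      using \<delta>(2)[OF i(1) xy(1,2)] xy(3) by auto
    then show ?thesis using shuffle_in[OF xy(1) i] shuffle_in[OF xy(2) i(1)] by simp
  next
    case False
    then have "\<not> (\<exists>i\<in>J. (S ^^ i) y \<in> U)" using \<delta>(2)[OF _ xy(1,2)] xy(3) by auto
    then show ?thesis using shuffle_out[OF xy(1) False] shuffle_out[OF xy(2)] xy(3) by simp
  qed
  then show "\<exists>\<delta>>0. \<forall>x\<in>M. \<forall>y\<in>M. d y x < \<delta> \<longrightarrow> d (shuffle J U \<sigma> y) (shuffle J U \<sigma> x) < \<epsilon>"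
    using \<delta>(1) \<epsilon> by (intro exI[of _ "min \<delta> \<epsilon>"] conjI ballI impI) simp_all
qed

text \<open>The first shuffle moves piece \<open>i\<close> onto piece \<open>\<sigma> i\<close>, and
  the second moves it back. In this form a permutation and its inverse can be inserted in either
  order.\<close>

lemma shuffle_shuffle:
  assumes "x \<in> M" "\<And>i. i \<in> J \<Longrightarrow> \<sigma> i \<in> J" "\<And>i. i \<in> J \<Longrightarrow> \<tau> (\<sigma> i) = i"
  shows "shuffle J U \<tau> (shuffle J U \<sigma> x) = x"
proof (cases "\<exists>i\<in>J. (S ^^ i) x \<in> U")
  case True
  then obtain i where i: "i \<in> J" "(S ^^ i) x \<in> U" by blast
  let ?y = "(T ^^ \<sigma> i) ((S ^^ i) x)"
  have "(S ^^ \<sigma> i) ?y = (S ^^ i) x" using assms(1) by simp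
  then have "shuffle J U \<tau> ?y = (T ^^ \<tau> (\<sigma> i)) ((S ^^ i) x)"
    using shuffle_in[of ?y "\<sigma> i" \<tau>] assms i by simp
  then show ?thesis using shuffle_in[OF assms(1) i] assms i by simp
qed (use assms(1) shuffle_out in simp)

lemma homeomorphic_shuffle:
  assumes "\<sigma> permutes J"
  shows "shuffle J U \<sigma> \<in> mspace (self_homeomorphisms X)"
proof -
  have cont: "continuous_map (mtopology_of X) (mtopology_of X) (shuffle J U \<rho>)" for \<rho>
    using uniformly_continuous_shuffle by (rule uniformly_continuous_imp_continuous_map)
  have "homeomorphic_maps (mtopology_of X) (mtopology_of X) (shuffle J U \<sigma>) (shuffle J U (inv \<sigma>))"
    unfolding homeomorphic_maps_def
    using cont shuffle_shuffle permutes_in_image[OF assms] permutes_inverses[OF assms]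
      permutes_in_image[OF permutes_inv[OF assms]] by simp
  then have "homeomorphic_map (mtopology_of X) (mtopology_of X) (shuffle J U \<sigma>)"
    using homeomorphic_map_maps by blast
  then show ?thesis by (simp add: mspace_self_homeomorphisms[OF compact] shuffle_def)
qed

end

text \<open>The extensional identity is the limit point of the compact set of infinite
  entropy.\<close>

lemma restrict_id_mem: "restrict id M \<in> mspace (self_homeomorphisms X)"
proof -
  have "homeomorphic_map (mtopology_of X) (mtopology_of X) (restrict id M)"
    by (rule homeomorphic_map_eq[of _ _ id]) auto
  then show ?thesis by (simp add: mspace_self_homeomorphisms[OF compact])
qed

lemma mspace_self_homeomorphisms_subset: "mspace (self_homeomorphisms X) \<subseteq> selfmaps X"
  by (auto simp: mspace_self_homeomorphisms[OF compact] selfmaps_def homeomorphic_imp_continuous_map)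

section \<open>Many separated homeomorphisms from long itineraries\<close>

text \<open>A first disagreement of two colored orbits cannot occur early when they start close together.\<close>

lemma late_disagreement:
  assumes "\<not> forward_equicontinuous" "mtopology_of X dim_le 0"
  obtains c :: "'a \<Rightarrow> 'a set" where "coloring c"
    "\<And>k. \<exists>n\<ge>k. \<exists>x\<in>M. \<exists>y\<in>M. (\<forall>i<n. c ((T ^^ i) x) = c ((T ^^ i) y)) \<and> c ((T ^^ n) x) \<noteq> c ((T ^^ n) y)"
proof -
  have "\<exists>\<epsilon>>0. \<forall>\<delta>>0. \<exists>n. \<exists>x\<in>M. \<exists>y\<in>M. d x y < \<delta> \<and> \<not> d ((T ^^ n) x) ((T ^^ n) y) < \<epsilon>"
    using assms(1) by (simp add: forward_equicontinuous_def imp_conv_disj not_less flip: not_le)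
  then obtain \<epsilon> where \<epsilon>: "\<epsilon> > 0"
    "\<forall>\<delta>>0. \<exists>n. \<exists>x\<in>M. \<exists>y\<in>M. d x y < \<delta> \<and> \<not> d ((T ^^ n) x) ((T ^^ n) y) < \<epsilon>"
    by (elim exE conjE)
  \<comment> \<open>Points at distance at least \<open>\<epsilon>\<close> get different colors, so
    every failure of equicontinuity at scale \<open>\<epsilon>\<close> shows in the colors.\<close>
  obtain c :: "'a \<Rightarrow> 'a set" where c: "coloring c" "\<And>x y. x \<in> M \<Longrightarrow> y \<in> M \<Longrightarrow> c x = c y \<Longrightarrow> d x y < \<epsilon>"
    using small_coloring[OF assms(2) \<epsilon>(1)] by metis
  show thesis
  proof (rule that[OF c(1)])
    fix k :: nat
    have "\<exists>\<delta>>0. \<forall>i\<in>{..<k}. \<forall>x\<in>M. \<forall>y\<in>M. d x y < \<delta> \<longrightarrow> c ((T ^^ i) x) = c ((T ^^ i) y)"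
      by (intro coloring_common_radius coloring_compose[OF c(1) uniformly_continuous_funpow]) simp
    then obtain \<delta> where \<delta>: "\<delta> > 0"
      "\<And>i x y. i < k \<Longrightarrow> x \<in> M \<Longrightarrow> y \<in> M \<Longrightarrow> d x y < \<delta> \<Longrightarrow> c ((T ^^ i) x) = c ((T ^^ i) y)" by blast
    obtain m x y where xy: "x \<in> M" "y \<in> M" "d x y < \<delta>" "\<not> d ((T ^^ m) x) ((T ^^ m) y) < \<epsilon>"
      using \<epsilon>(2) \<delta>(1) by blast
    define n where "n = (LEAST n. c ((T ^^ n) x) \<noteq> c ((T ^^ n) y))"
    have "c ((T ^^ m) x) \<noteq> c ((T ^^ m) y)" using c(2) xy funpow_mem by blast
    then have n: "c ((T ^^ n) x) \<noteq> c ((T ^^ n) y)" "\<forall>i<n. c ((T ^^ i) x) = c ((T ^^ i) y)"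
      unfolding n_def
      using LeastI[of "\<lambda>n. c ((T ^^ n) x) \<noteq> c ((T ^^ n) y)" m]
        not_less_Least[of _ "\<lambda>n. c ((T ^^ n) x) \<noteq> c ((T ^^ n) y)"] by blast+
    have "n \<ge> k" using n(1) \<delta>(2) xy(1-3) by (meson not_le)
    then show "\<exists>n\<ge>k. \<exists>x\<in>M. \<exists>y\<in>M. (\<forall>i<n. c ((T ^^ i) x) = c ((T ^^ i) y)) \<and> c ((T ^^ n) x) \<noteq> c ((T ^^ n) y)"
      using n xy(1,2) by blast
  qed
qed

text \<open>Entering both orbits \<open>n - j\<close> steps late gives two itineraries that first
  differ at step \<open>j\<close>. Hence the words branch at every depth up to \<open>n\<close>,
  there are at least \<open>n + 2\<close> of them, and one of the two orbits carries at least
  half.\<close>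

lemma many_itineraries:
  assumes "x \<in> M" "y \<in> M" "\<forall>i<n. c ((T ^^ i) x) = c ((T ^^ i) y)" "c ((T ^^ n) x) \<noteq> c ((T ^^ n) y)"
  obtains a I where "a \<in> M" "finite I" "n < 2 * card I"
    "inj_on (\<lambda>i. map (\<lambda>t. c ((T ^^ t) ((T ^^ i) a))) [0..<Suc n]) I"
proof -
  \<comment> \<open>The words have length \<open>n + 1\<close> so as to include step
    \<open>n\<close>, where the colors differ.\<close>
  define W where "W = (\<lambda>p. map (\<lambda>t. c ((T ^^ t) p)) [0..<Suc n])"
  define Orb where "Orb z = (\<lambda>i. (T ^^ i) z) ` {..n}" for z
  have "Suc n + 1 \<le> card (W ` (Orb x \<union> Orb y))"
    unfolding W_def
  proof (rule card_words_ge)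
    fix j assume j: "j < Suc n"
    have eq: "(T ^^ t) ((T ^^ (n - j)) z) = (T ^^ (t + (n - j))) z" for t z by (simp add: funpow_add)
    show "\<exists>u\<in>Orb x \<union> Orb y. \<exists>v\<in>Orb x \<union> Orb y.
        (\<forall>t<j. c ((T ^^ t) u) = c ((T ^^ t) v)) \<and> c ((T ^^ j) u) \<noteq> c ((T ^^ j) v)"
    proof -
      let ?u = "(T ^^ (n - j)) x" and ?v = "(T ^^ (n - j)) y"
      have "?u \<in> Orb x \<union> Orb y" "?v \<in> Orb x \<union> Orb y" by (auto simp: Orb_def)
      moreover have "\<forall>t<j. c ((T ^^ t) ?u) = c ((T ^^ t) ?v)"
        using assms(3) j unfolding eq by auto
      moreover have "c ((T ^^ j) ?u) \<noteq> c ((T ^^ j) ?v)"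
        using assms(4) j unfolding eq by auto
      ultimately show ?thesis by blast
    qed
  qed (auto simp: Orb_def)
  also have "\<dots> = card (W ` Orb x \<union> W ` Orb y)" by (simp only: image_Un)
  also have "\<dots> \<le> card (W ` Orb x) + card (W ` Orb y)" by (rule card_Un_le)
  finally have "n < 2 * card (W ` Orb x) \<or> n < 2 * card (W ` Orb y)" by linarith
  then obtain a where a: "a \<in> M" "n < 2 * card (W ` Orb a)" using assms(1,2) by blast
  have "W ` Orb a = (\<lambda>i. W ((T ^^ i) a)) ` {..n}" by (simp add: Orb_def image_image)
  then have "W ` Orb a \<subseteq> (\<lambda>i. W ((T ^^ i) a)) ` {..n}" by simp
  \<comment> \<open>One time is chosen for each itinerary on the orbit of \<open>a\<close>.\<close>
  then obtain I where I: "I \<subseteq> {..n}" "inj_on (\<lambda>i. W ((T ^^ i) a)) I" "W ` Orb a = (\<lambda>i. W ((T ^^ i) a)) ` I"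
    unfolding subset_image_inj by blast
  show thesis
  proof (rule that[OF a(1)])
    show "finite I" using I(1) finite_subset by blast
    show "n < 2 * card I" using a(2) unfolding I(3) card_image[OF I(2)] .
  qed (use I(2) in \<open>simp only: W_def\<close>)
qed

text \<open>Two colorings act at different scales: \<open>c\<close>, fixed before \<open>k\<close>,
  separates orbits by \<open>\<epsilon>\<close>, while \<open>q\<close>, chosen for
  \<open>k\<close>, keeps the shuffles near the identity. The number of colors of \<open>q\<close>
  is fixed before \<open>N\<close>, so the number of permuted pieces is at least linear in
  \<open>N\<close>.\<close>

lemma many_separated_homeomorphisms:
  assumes noneq: "\<not> forward_equicontinuous" and dim: "mtopology_of X dim_le 0"
  shows "\<exists>\<epsilon>>0. \<forall>k. \<exists>n\<ge>k. n \<ge> 1 \<and> (\<exists>E. finite E \<and> E \<subseteq> mspace (self_homeomorphisms X) \<and>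
      (\<forall>\<phi>\<in>E. uniform_dist X (restrict id M) \<phi> \<le> 1 / real (Suc k)) \<and>
      separated (self_homeomorphisms X) (envelope_map X T) n \<epsilon> E \<and>
      exp (real k * real n) \<le> real (card E))"
proof -
  obtain c :: "'a \<Rightarrow> 'a set" where c: "coloring c"
    "\<And>k. \<exists>n\<ge>k. \<exists>x\<in>M. \<exists>y\<in>M. (\<forall>i<n. c ((T ^^ i) x) = c ((T ^^ i) y)) \<and> c ((T ^^ n) x) \<noteq> c ((T ^^ n) y)"
    using late_disagreement[OF noneq dim] by metis
  obtain \<epsilon> where \<epsilon>: "\<epsilon> > 0" "\<And>x y. x \<in> M \<Longrightarrow> y \<in> M \<Longrightarrow> c x \<noteq> c y \<Longrightarrow> d x y > \<epsilon>"
    using coloring_separates[OF c(1)] by metis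
  show ?thesis
  proof (intro exI[of _ \<epsilon>] conjI allI)
    show "\<epsilon> > 0" by (rule \<epsilon>(1))
    fix k :: nat
    obtain q :: "'a \<Rightarrow> 'a set" where q: "coloring q" "finite (q ` M)"
      "\<And>x y. x \<in> M \<Longrightarrow> y \<in> M \<Longrightarrow> q x = q y \<Longrightarrow> d x y < 1 / real (Suc k)"
      using small_coloring[OF dim, of "1 / real (Suc k)"] by auto
    define r where "r = card (q ` M)"
    \<comment> \<open>Since \<open>Suc N\<close> will be at most \<open>2 * r * card J\<close>, the
      required exponential is at most the power of this base with exponent \<open>card J\<close>;
      from \<open>m0\<close> on, factorials dominate such powers.\<close>
    obtain m0 where m0: "\<And>m. m \<ge> m0 \<Longrightarrow> exp (real k * (2 * real r)) ^ m \<le> fact m"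
      using eventually_power_le_fact[of "exp (real k * (2 * real r))"]
      unfolding eventually_sequentially by blast
    \<comment> \<open>The lower bound \<open>2 * r * m0\<close> will force
      \<open>m0 \<le> card J\<close>.\<close>
    obtain N x y where N: "N \<ge> max k (2 * r * m0)" and xy: "x \<in> M" "y \<in> M"
      "\<forall>i<N. c ((T ^^ i) x) = c ((T ^^ i) y)" "c ((T ^^ N) x) \<noteq> c ((T ^^ N) y)"
      using c(2) by blast
    obtain a I where aI: "a \<in> M" "finite I" "N < 2 * card I"
      "inj_on (\<lambda>i. map (\<lambda>t. c ((T ^^ t) ((T ^^ i) a))) [0..<Suc N]) I"
      using many_itineraries[of x y N c] xy by blast
    have "q ` M \<noteq> {}" "(\<lambda>i. q ((T ^^ i) a)) ` I \<subseteq> q ` M" using aI(1) by auto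
    then obtain b where b: "card I \<le> r * card {i \<in> I. q ((T ^^ i) a) = b}"
      using pigeonhole_card_mult[OF aI(2) q(2)] unfolding r_def by metis
    define J where "J = {i \<in> I. q ((T ^^ i) a) = b}"
    have finJ: "finite J" using aI(2) by (simp add: J_def)
    have differ: "\<exists>t\<le>N. c ((T ^^ t) ((T ^^ i) a)) \<noteq> c ((T ^^ t) ((T ^^ j) a))"
      if "i \<in> J" "j \<in> J" "i \<noteq> j" for i j
    proof (rule ccontr)
      assume "\<not> ?thesis"
      then have "map (\<lambda>t. c ((T ^^ t) ((T ^^ i) a))) [0..<Suc N] = map (\<lambda>t. c ((T ^^ t) ((T ^^ j) a))) [0..<Suc N]"
        by (intro map_cong) auto
      then show False using inj_onD[OF aI(4), of i j] that by (simp add: J_def)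
    qed
    \<comment> \<open>The itineraries in this definition make the images of \<open>U\<close> under
      \<open>T ^^ i\<close> with \<open>i\<close> in \<open>J\<close> pairwise disjoint; the colors
      of \<open>q\<close> put all these images into the single small piece of color
      \<open>b\<close>.\<close>
    define U where "U = {u \<in> M. \<forall>i\<in>J. q ((T ^^ i) u) = q ((T ^^ i) a) \<and>
        (\<forall>t\<le>N. c ((T ^^ t) ((T ^^ i) u)) = c ((T ^^ t) ((T ^^ i) a)))}"
    have aU: "a \<in> U" using aI(1) by (simp add: U_def)
    have colU: "coloring (\<lambda>x. x \<in> U)"
    proof -
      have col: "coloring (\<lambda>u. c ((T ^^ t) ((T ^^ i) u)))" for t i
        using coloring_compose[OF coloring_compose[OF c(1) uniformly_continuous_funpow[of t]]
            uniformly_continuous_funpow[of i]] .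
      have "\<exists>\<delta>>0. \<forall>i\<in>J. \<forall>u\<in>M. \<forall>v\<in>M. d u v < \<delta> \<longrightarrow> q ((T ^^ i) u) = q ((T ^^ i) v)"
        by (intro coloring_common_radius finJ coloring_compose[OF q(1) uniformly_continuous_funpow])
      then obtain \<delta>1 where 1: "\<delta>1 > 0" "\<And>i u v. i \<in> J \<Longrightarrow> u \<in> M \<Longrightarrow> v \<in> M \<Longrightarrow> d u v < \<delta>1 \<Longrightarrow>
          q ((T ^^ i) u) = q ((T ^^ i) v)" by blast
      have "\<exists>\<delta>>0. \<forall>p\<in>J \<times> {..N}. \<forall>u\<in>M. \<forall>v\<in>M. d u v < \<delta> \<longrightarrow>
          c ((T ^^ snd p) ((T ^^ fst p) u)) = c ((T ^^ snd p) ((T ^^ fst p) v))"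
        by (intro coloring_common_radius col) (simp add: finJ)
      then obtain \<delta>2 where \<delta>2: "\<delta>2 > 0" "\<And>p u v. p \<in> J \<times> {..N} \<Longrightarrow> u \<in> M \<Longrightarrow> v \<in> M \<Longrightarrow> d u v < \<delta>2 \<Longrightarrow>
          c ((T ^^ snd p) ((T ^^ fst p) u)) = c ((T ^^ snd p) ((T ^^ fst p) v))" by blast
      have 2: "c ((T ^^ t) ((T ^^ i) u)) = c ((T ^^ t) ((T ^^ i) v))"
        if "i \<in> J" "t \<le> N" "u \<in> M" "v \<in> M" "d u v < \<delta>2" for i t u v
        using \<delta>2(2)[of "(i, t)" u v] that by simp
      show ?thesis unfolding coloring_def
      proof (intro exI conjI ballI impI)
        show "u \<in> U \<longleftrightarrow> v \<in> U" if "u \<in> M" "v \<in> M" "d u v < min \<delta>1 \<delta>2" for u v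
          using 1(2)[OF _ that(1,2)] 2[OF _ _ that(1,2)] that unfolding U_def by auto
      qed (use 1(1) \<delta>2(1) in simp)
    qed
    \<comment> \<open>A common point would have the itineraries of two different orbit points at
      once.\<close>
    have disj: "i = j" if ij: "i \<in> J" "j \<in> J" "z \<in> M" "(S ^^ i) z \<in> U" "(S ^^ j) z \<in> U" for i j z
    proof (rule ccontr)
      assume "i \<noteq> j"
      then obtain t where t: "t \<le> N" "c ((T ^^ t) ((T ^^ i) a)) \<noteq> c ((T ^^ t) ((T ^^ j) a))"
        using differ[OF ij(1,2)] by blast
      have "c ((T ^^ t) z) = c ((T ^^ t) ((T ^^ l) a))" if "l \<in> J" "(S ^^ l) z \<in> U" for l
      proof -
        have "c ((T ^^ t) ((T ^^ l) ((S ^^ l) z))) = c ((T ^^ t) ((T ^^ l) a))"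
          using that t(1) unfolding U_def by blast
        then show ?thesis using ij(3) by simp
      qed
      then show False using t(2) ij by metis
    qed
    let ?\<phi> = "shuffle J U"
    define E where "E = ?\<phi> ` {\<sigma>. \<sigma> permutes J}"
    have E: "E \<subseteq> mspace (self_homeomorphisms X)"
      using homeomorphic_shuffle[OF finJ colU disj] by (auto simp: E_def)
    have at: "?\<phi> \<sigma> ((T ^^ i) a) = (T ^^ \<sigma> i) a" if "i \<in> J" for \<sigma> i
      using shuffle_in[OF finJ colU disj, where x = "(T ^^ i) a" and i = i and \<sigma> = \<sigma>] that aU aI(1) by simp
    have moved: "\<exists>i\<in>J. \<sigma> i \<in> J \<and> \<tau> i \<in> J \<and> \<sigma> i \<noteq> \<tau> i"
      if st: "\<sigma> permutes J" "\<tau> permutes J" "\<sigma> \<noteq> \<tau>" for \<sigma> \<tau>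
    proof -
      obtain i where i: "\<sigma> i \<noteq> \<tau> i" using st(3) by (meson ext)
      then have "i \<in> J" using permutes_not_in[OF st(1)] permutes_not_in[OF st(2)] by force
      then show ?thesis using i permutes_in_image[OF st(1)] permutes_in_image[OF st(2)] by blast
    qed
    \<comment> \<open>Where the permutations differ, the two maps send an orbit point to orbit
      points with different itineraries. The disagreement occurs at a time \<open>t \<le> N\<close>,
      hence the Bowen distance over \<open>Suc N\<close> steps.\<close>
    have far: "bowen_dist (self_homeomorphisms X) (envelope_map X T) (Suc N) (?\<phi> \<sigma>) (?\<phi> \<tau>) > \<epsilon>"
      if st: "\<sigma> permutes J" "\<tau> permutes J" "\<sigma> \<noteq> \<tau>" for \<sigma> \<tau>
    proof -
      obtain i where i: "i \<in> J" "\<sigma> i \<in> J" "\<tau> i \<in> J" "\<sigma> i \<noteq> \<tau> i" using moved[OF st] by blast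
      obtain t where t: "t \<le> N" "c ((T ^^ t) ((T ^^ \<sigma> i) a)) \<noteq> c ((T ^^ t) ((T ^^ \<tau> i) a))"
        using differ[OF i(2-4)] by blast
      then have "\<epsilon> < d ((T ^^ t) (?\<phi> \<sigma> ((T ^^ i) a))) ((T ^^ t) (?\<phi> \<tau> ((T ^^ i) a)))"
        using \<epsilon>(2) at[OF i(1)] aI(1) by simp
      also have "\<dots> \<le> bowen_dist (self_homeomorphisms X) (envelope_map X T) (Suc N) (?\<phi> \<sigma>) (?\<phi> \<tau>)"
        using E st t(1) aI(1) mspace_self_homeomorphisms_subset
        by (intro bowen_dist_ge) (auto simp: E_def mdist_self_homeomorphisms[OF compact])
      finally show ?thesis .
    qed
    have sep: "separated (self_homeomorphisms X) (envelope_map X T) (Suc N) \<epsilon> E"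
      unfolding separated_def E_def using far by blast
    have inj: "inj_on ?\<phi> {\<sigma>. \<sigma> permutes J}"
    proof (rule inj_onI, rule ccontr)
      fix \<sigma> \<tau> assume st: "\<sigma> \<in> {\<sigma>. \<sigma> permutes J}" "\<tau> \<in> {\<sigma>. \<sigma> permutes J}" "?\<phi> \<sigma> = ?\<phi> \<tau>" "\<sigma> \<noteq> \<tau>"
      then obtain i where i: "i \<in> J" "\<sigma> i \<in> J" "\<tau> i \<in> J" "\<sigma> i \<noteq> \<tau> i" using moved[of \<sigma> \<tau>] by blast
      have "(T ^^ \<sigma> i) a = (T ^^ \<tau> i) a" using at[OF i(1), of \<sigma>] at[OF i(1), of \<tau>] st(3) by simp
      then show False using differ[OF i(2-4)] by simp
    qed
    have "card E = fact (card J)"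
      unfolding E_def card_image[OF inj] using card_permutations[OF refl finJ] .
    moreover have "exp (real k * real (Suc N)) \<le> fact (card J)"
    proof -
      have "N < 2 * (r * card J)" using aI(3) b unfolding J_def by linarith
      then have le: "Suc N \<le> 2 * r * card J" by simp
      have "2 * r * m0 < 2 * r * card J" using N le by linarith
      then have "m0 \<le> card J" by simp
      have "real k * real (Suc N) \<le> real k * real (2 * r * card J)"
        using le by (intro mult_left_mono) (simp_all only: of_nat_le_iff of_nat_0_le_iff)
      also have "\<dots> = real (card J) * (real k * (2 * real r))" by simp
      finally have "exp (real k * real (Suc N)) \<le> exp (real (card J) * (real k * (2 * real r)))"
        by (simp only: exp_le_cancel_iff)
      also have "\<dots> = exp (real k * (2 * real r)) ^ card J" by (rule exp_of_nat_mult)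
      also have "\<dots> \<le> fact (card J)" using m0 \<open>m0 \<le> card J\<close> .
      finally show ?thesis .
    qed
    moreover have "uniform_dist X (restrict id M) (?\<phi> \<sigma>) \<le> 1 / real (Suc k)" if \<sigma>: "\<sigma> permutes J" for \<sigma>
    proof (rule uniform_dist_le)
      fix z assume z: "z \<in> M"
      show "d (restrict id M z) (?\<phi> \<sigma> z) \<le> 1 / real (Suc k)"
      proof (cases "\<exists>i\<in>J. (S ^^ i) z \<in> U")
        case True
        then obtain i where i: "i \<in> J" "(S ^^ i) z \<in> U" by blast
        \<comment> \<open>With \<open>l = i\<close> this is the color of \<open>z\<close>, with
          \<open>l = \<sigma> i\<close> that of its image; equal colors mean that \<open>z\<close>
          moves by less than \<open>1 / real (Suc k)\<close>.\<close>
        have qb: "q ((T ^^ l) ((S ^^ i) z)) = b" if "l \<in> J" for l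
          using i(2) that unfolding U_def J_def by auto
        have image: "?\<phi> \<sigma> z = (T ^^ \<sigma> i) ((S ^^ i) z)" by (rule shuffle_in[OF finJ colU disj z i])
        then have mem: "?\<phi> \<sigma> z \<in> M" using z by simp
        have "q z = b" using qb[OF i(1)] z by simp
        moreover have "q (?\<phi> \<sigma> z) = b"
          unfolding image using qb i(1) permutes_in_image[OF \<sigma>] by blast
        ultimately have "d z (?\<phi> \<sigma> z) < 1 / real (Suc k)"
          by (intro q(3)[OF z mem]) (rule trans[OF _ sym])
        then show ?thesis using z by (simp only: restrict_apply' id_apply less_imp_le)
      next
        case False
        have "?\<phi> \<sigma> z = z" by (rule shuffle_out[OF finJ colU disj z False])
        then show ?thesis using z by simp
      qed
    qed simp
    then have "\<forall>\<phi>\<in>E. uniform_dist X (restrict id M) \<phi> \<le> 1 / real (Suc k)" by (auto simp: E_def)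
    moreover have "finite E" unfolding E_def using finite_permutations[OF finJ] by simp
    ultimately show "\<exists>n\<ge>k. n \<ge> 1 \<and> (\<exists>E. finite E \<and> E \<subseteq> mspace (self_homeomorphisms X) \<and>
      (\<forall>\<phi>\<in>E. uniform_dist X (restrict id M) \<phi> \<le> 1 / real (Suc k)) \<and>
      separated (self_homeomorphisms X) (envelope_map X T) n \<epsilon> E \<and>
      exp (real k * real n) \<le> real (card E))"
      using E sep N by (intro exI[of _ "Suc N"] conjI exI[of _ E]) auto
  qed
qed

section \<open>Infinite entropy and comparison of the two envelopes\<close>

text \<open>The scale \<open>\<epsilon>\<close> is the same for all \<open>k\<close>, so one compact
  set collects the separated families of all \<open>k\<close> and has unbounded growth rates at that
  scale.\<close>

lemma entropy_eq_infinity: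
  assumes "\<not> forward_equicontinuous" "mtopology_of X dim_le 0"
  shows "top_entropy (self_homeomorphisms X) (envelope_map X T) = \<infinity>"
proof -
  let ?Z = "self_homeomorphisms X" and ?F = "envelope_map X T"
  interpret Z: Metric_space "mspace ?Z" "mdist ?Z" by simp
  \<comment> \<open>A single predicate lets the times and the families be chosen together as
    functions of \<open>k\<close>.\<close>
  define Q where "Q \<epsilon> k n E \<longleftrightarrow> n \<ge> k \<and> n \<ge> 1 \<and> finite E \<and> E \<subseteq> mspace ?Z \<and>
      (\<forall>\<phi>\<in>E. uniform_dist X (restrict id M) \<phi> \<le> 1 / real (Suc k)) \<and>
      separated ?Z ?F n \<epsilon> E \<and> exp (real k * real n) \<le> real (card E)" for \<epsilon> k n E
  have "\<exists>\<epsilon>>0. \<forall>k. \<exists>n E. Q \<epsilon> k n E"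
    using many_separated_homeomorphisms[OF assms] unfolding Q_def by blast
  then obtain \<epsilon> where \<epsilon>: "\<epsilon> > 0" "\<forall>k. \<exists>n E. Q \<epsilon> k n E" by blast
  then obtain n E where Q: "\<And>k. Q \<epsilon> k (n k) (E k)" by metis
  have nE: "n k \<ge> k" "n k \<ge> 1" "finite (E k)" "E k \<subseteq> mspace ?Z" "separated ?Z ?F (n k) \<epsilon> (E k)"
      "exp (real k * real (n k)) \<le> real (card (E k))"
      "\<phi> \<in> E k \<Longrightarrow> uniform_dist X (restrict id M) \<phi> \<le> 1 / real (Suc k)" for k \<phi>
    using Q[of k] unfolding Q_def by blast+
  define K where "K = insert (restrict id M) (\<Union>k. E k)"
  have K: "compactin (mtopology_of ?Z) K"
    unfolding mtopology_of_def K_def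
    by (rule Z.compactin_insert_null_sequence)
      (use restrict_id_mem nE(3,4,7) in \<open>auto simp: mdist_self_homeomorphisms[OF compact]\<close>)
  have "entropy_on ?Z ?F K = \<infinity>"
  proof (rule entropy_on_eq_infinity[OF \<epsilon>(1)])
    show "\<exists>n\<ge>k. n \<ge> 1 \<and> (\<exists>E. E \<subseteq> K \<and> finite E \<and> separated ?Z ?F n \<epsilon> E \<and>
        exp (real k * real n) \<le> real (card E))" for k
      using nE by (intro exI[of _ "n k"] conjI exI[of _ "E k"]) (auto simp: K_def)
    fix m :: nat and \<eta> :: real assume m: "m \<ge> 1" and \<eta>: "\<eta> > 0"
    \<comment> \<open>For a fixed time \<open>m\<close> the finitely many iterates share a modulus,
      which bounds the separated subsets of \<open>K\<close>.\<close>
    have "\<exists>\<delta>>0. \<forall>t\<in>{..<m}. \<forall>x\<in>M. \<forall>y\<in>M. d x y < \<delta> \<longrightarrow> d ((T ^^ t) x) ((T ^^ t) y) < \<eta>"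
      by (intro common_radius uniformly_continuous_mapD uniformly_continuous_funpow \<eta>) simp
    then obtain \<delta> where \<delta>: "\<delta> > 0"
      "\<And>t x y. t < m \<Longrightarrow> x \<in> M \<Longrightarrow> y \<in> M \<Longrightarrow> d x y < \<delta> \<Longrightarrow> d ((T ^^ t) x) ((T ^^ t) y) < \<eta>" by blast
    show "\<exists>B. \<forall>E. E \<subseteq> K \<longrightarrow> finite E \<longrightarrow> separated ?Z ?F m \<eta> E \<longrightarrow> card E \<le> B"
      by (rule separated_card_bounded[OF mdist_self_homeomorphisms[OF compact]
            mspace_self_homeomorphisms_subset K \<eta> \<delta>(1)]) (use \<delta>(2) m in metis)
  qed
  then show ?thesis unfolding top_entropy_def using K
    by (metis (mono_tags, lifting) SUP_upper ereal_infty_less_eq(1) mem_Collect_eq)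
qed

text \<open>Both envelopes have the same distance, so \<open>entropy_on\<close> agrees on them, and
  a compact subset of the subspace of homeomorphisms is compact in the whole space.\<close>

lemma entropy_mono:
  "top_entropy (self_homeomorphisms X) (envelope_map X T) \<le> top_entropy (continuous_selfmaps X) (envelope_map X T)"
proof -
  have "entropy_on (self_homeomorphisms X) (envelope_map X T) = entropy_on (continuous_selfmaps X) (envelope_map X T)"
    by (simp add: fun_eq_iff entropy_on_def sep_def separated_def bowen_dist_def
        mdist_self_homeomorphisms[OF compact] mdist_continuous_selfmaps[OF compact])
  then show ?thesis unfolding top_entropy_def
    by (intro SUP_mono) (auto simp: self_homeomorphisms_def mtopology_of_submetric compactin_subtopology)
qed

end

theorem theorem2:
  fixes X :: "'a metric" and T :: "'a \<Rightarrow> 'a"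
  assumes "compact_space (mtopology_of X)"
    and "mtopology_of X dim_le 0"
    and "homeomorphic_map (mtopology_of X) (mtopology_of X) T"
  shows "((top_entropy (continuous_selfmaps X) (envelope_map X T) = 0 \<and>
           top_entropy (self_homeomorphisms X) (envelope_map X T) = 0) \<or>
          (top_entropy (continuous_selfmaps X) (envelope_map X T) = \<infinity> \<and>
           top_entropy (self_homeomorphisms X) (envelope_map X T) = \<infinity>)) \<and>
         ((top_entropy (continuous_selfmaps X) (envelope_map X T) = 0 \<and>
           top_entropy (self_homeomorphisms X) (envelope_map X T) = 0) \<longleftrightarrow>
          equicontinuous_homeo X T)"
proof -
  interpret compact_homeomorphism X T using assms by unfold_locales
  have iff: "equicontinuous_homeo X T \<longleftrightarrow> forward_equicontinuous"
    using equicontinuous_imp_forward forward_imp_equicontinuous by blast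
  show ?thesis
  proof (cases forward_equicontinuous)
    case True
    then have "top_entropy (continuous_selfmaps X) (envelope_map X T) = 0"
      "top_entropy (self_homeomorphisms X) (envelope_map X T) = 0"
      using mspace_self_homeomorphisms_subset
      by (auto intro!: entropy_eq_0 simp: mdist_self_homeomorphisms[OF compact]
          mdist_continuous_selfmaps[OF compact] mspace_continuous_selfmaps[OF compact])
    then show ?thesis using iff True by simp
  next
    case False
    then have "top_entropy (self_homeomorphisms X) (envelope_map X T) = \<infinity>"
      using entropy_eq_infinity assms(2) by blast
    then have "top_entropy (continuous_selfmaps X) (envelope_map X T) = \<infinity>"
      "top_entropy (self_homeomorphisms X) (envelope_map X T) = \<infinity>"
      using entropy_mono by auto
    then show ?thesis using iff False by simp
  qed
qed
end
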